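(* Let $G_\Gamma$ be a graph product of non-trivial cyclic groups over a finite simplicial graph $\Gamma$, where the finite vertex groups have prime power orders. Let $\Delta$ be the induced subgraph of $\Gamma$ generated by the vertices $v\in V(\Gamma)$ such that $st(v)=V(\Gamma)$. The automorphism group $\mathrm{Aut}(G_\Gamma)$ does not have a non-trivial finite normal subgroup if and only if one of the following conditions holds: (i) $V(\Delta)=\emptyset$; or (ii) $G_\Gamma\cong\mathbb{Z}/2\mathbb{Z}$; or (iii) $V(\Delta)=\{v_1\}$, $G_{v_1}\cong\mathbb{Z}/2\mathbb{Z}$, $V(\Gamma)-V(\Delta)=\{w_1,\ldots,w_m\}$ with $m\geq 1$, and $ord(G_{w_j})<\infty$ and $2\nmid ord(G_{w_j})$ for all $1\leq j\leq m$; or (iv) for every $v\in V(\Delta)$ we have $G_v\cong\mathbb{Z}$, and there exists a $w\in V(\Gamma)-V(\Delta)$ such that $G_w\cong\mathbb{Z}$.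
   Context: Given a finite simplicial graph $\Gamma$ and non-trivial groups $\{G_u\mid u\in V(\Gamma)\}$ (the vertex groups), the graph product $G_\Gamma$ is the quotient of the free product $\ast_{u\in V(\Gamma)}G_u$ by the normal closure of all commutators $[g,h]$ with $g\in G_u$, $h\in G_v$, $\{u,v\}\in E(\Gamma)$. For $v\in V(\Gamma)$, $st(v)=\{v\}\cup\{w\in V(\Gamma)\mid\{v,w\}\in E(\Gamma)\}$. $ord(G)$ denotes the order of the group $G$. *)

theory Defs
  imports
    "HOL-Algebra.Bij"
    "HOL-Algebra.Elementary_Groups"
    "HOL-Number_Theory.Prime_Powers"
    "Graph_Theory.Digraph_Component"
    "Graph_Theory.Pair_Digraph"
begin

section \<open>Free products\<close>

text \<open>
  A letter (u, g) stands for the element g of the group G u. The free product of the family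
  G over the index set I consists of the words in these letters, modulo the congruence that
  deletes identity letters and multiplies adjacent letters from the same group; the operation is
  concatenation.
\<close>

definition fp_words ::
    "'v set \<Rightarrow> ('v \<Rightarrow> ('a, 'b) monoid_scheme) \<Rightarrow> ('v \<times> 'a) list set" where
  "fp_words I G = lists (SIGMA u:I. carrier (G u))"

inductive_set fp_rel ::
    "'v set \<Rightarrow> ('v \<Rightarrow> ('a, 'b) monoid_scheme) \<Rightarrow> (('v \<times> 'a) list \<times> ('v \<times> 'a) list) set"
  for I :: "'v set" and G :: "'v \<Rightarrow> ('a, 'b) monoid_scheme"
where
  refl: "xs \<in> fp_words I G \<Longrightarrow> (xs, xs) \<in> fp_rel I G"
| sym: "(xs, ys) \<in> fp_rel I G \<Longrightarrow> (ys, xs) \<in> fp_rel I G"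
| trans: "\<lbrakk>(xs, ys) \<in> fp_rel I G; (ys, zs) \<in> fp_rel I G\<rbrakk> \<Longrightarrow> (xs, zs) \<in> fp_rel I G"
| unit: "\<lbrakk>xs \<in> fp_words I G; ys \<in> fp_words I G; u \<in> I\<rbrakk>
    \<Longrightarrow> (xs @ [(u, \<one>\<^bsub>G u\<^esub>)] @ ys, xs @ ys) \<in> fp_rel I G"
| mult: "\<lbrakk>xs \<in> fp_words I G; ys \<in> fp_words I G; u \<in> I; g \<in> carrier (G u); h \<in> carrier (G u)\<rbrakk>
    \<Longrightarrow> (xs @ [(u, g), (u, h)] @ ys, xs @ [(u, g \<otimes>\<^bsub>G u\<^esub> h)] @ ys) \<in> fp_rel I G"

definition free_product ::
    "'v set \<Rightarrow> ('v \<Rightarrow> ('a, 'b) monoid_scheme) \<Rightarrow> ('v \<times> 'a) list set monoid" where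
  "free_product I G =
     \<lparr>carrier = fp_words I G // fp_rel I G,
      monoid.mult = (\<lambda>X Y. \<Union>x\<in>X. \<Union>y\<in>Y. fp_rel I G `` {x @ y}),
      one = fp_rel I G `` {[]}\<rparr>"

definition fp_incl ::
    "'v set \<Rightarrow> ('v \<Rightarrow> ('a, 'b) monoid_scheme) \<Rightarrow> 'v \<Rightarrow> 'a \<Rightarrow> ('v \<times> 'a) list set" where
  "fp_incl I G u g = fp_rel I G `` {[(u, g)]}"


section \<open>Graph products\<close>

definition normal_closure :: "('a, 'b) monoid_scheme \<Rightarrow> 'a set \<Rightarrow> 'a set" where
  "normal_closure G S = (\<lambda>N. N \<lhd> G) hull S"

definition commutator :: "('a, 'b) monoid_scheme \<Rightarrow> 'a \<Rightarrow> 'a \<Rightarrow> 'a" where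
  "commutator G x y = x \<otimes>\<^bsub>G\<^esub> y \<otimes>\<^bsub>G\<^esub> inv\<^bsub>G\<^esub> x \<otimes>\<^bsub>G\<^esub> inv\<^bsub>G\<^esub> y"

text \<open>
  A finite simplicial graph is rendered as a \<^locale>\<open>pair_graph\<close>: a finite vertex set with a
  symmetric loop-free arc relation. An edge between u and v corresponds to the two arcs
  (u, v) and (v, u).
\<close>

definition gp_relators ::
    "'v pair_pre_digraph \<Rightarrow> ('v \<Rightarrow> ('a, 'b) monoid_scheme) \<Rightarrow> ('v \<times> 'a) list set set" where
  "gp_relators \<Gamma> G =
     {commutator (free_product (pverts \<Gamma>) G)
        (fp_incl (pverts \<Gamma>) G u g) (fp_incl (pverts \<Gamma>) G v h) | u v g h.
        (u, v) \<in> parcs \<Gamma> \<and> g \<in> carrier (G u) \<and> h \<in> carrier (G v)}"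

definition graph_product ::
    "'v pair_pre_digraph \<Rightarrow> ('v \<Rightarrow> ('a, 'b) monoid_scheme) \<Rightarrow> ('v \<times> 'a) list set set monoid" where
  "graph_product \<Gamma> G =
     free_product (pverts \<Gamma>) G
       Mod normal_closure (free_product (pverts \<Gamma>) G) (gp_relators \<Gamma> G)"

definition star :: "'v pair_pre_digraph \<Rightarrow> 'v \<Rightarrow> 'v set" where
  "star \<Gamma> v = {v} \<union> {w \<in> pverts \<Gamma>. (v, w) \<in> parcs \<Gamma>}"


section \<open>Well-definedness\<close>

lemma fp_words_simps [simp]:
  "[] \<in> fp_words I G"
  "x # xs \<in> fp_words I G \<longleftrightarrow> fst x \<in> I \<and> snd x \<in> carrier (G (fst x)) \<and> xs \<in> fp_words I G"
  "xs @ ys \<in> fp_words I G \<longleftrightarrow> xs \<in> fp_words I G \<and> ys \<in> fp_words I G"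
  by (auto simp: fp_words_def Sigma_def prod_eq_iff)

lemma fp_rel_words:
  assumes G: "\<And>u. u \<in> I \<Longrightarrow> group (G u)" and "(xs, ys) \<in> fp_rel I G"
  shows "xs \<in> fp_words I G \<and> ys \<in> fp_words I G"
  using assms(2)
proof induction
  case (unit xs ys u)
  interpret group "G u" by (rule G[OF unit(3)])
  show ?case using unit by simp
next
  case (mult xs ys u g h)
  interpret group "G u" by (rule G[OF mult(3)])
  show ?case using mult by simp
qed simp_all

lemma equiv_fp_rel:
  assumes G: "\<And>u. u \<in> I \<Longrightarrow> group (G u)"
  shows "equiv (fp_words I G) (fp_rel I G)"
proof (rule equivI)
  show "fp_rel I G \<subseteq> fp_words I G \<times> fp_words I G"
    using fp_rel_words[of I G, OF G] by fast
  show "refl_on (fp_words I G) (fp_rel I G)"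
    by (auto intro: refl_onI fp_rel.refl)
  show "Relation.sym (fp_rel I G)"
    by (auto intro: symI fp_rel.sym)
  show "Relation.trans (fp_rel I G)"
    by (blast intro: transI fp_rel.trans)
qed

lemma fp_rel_append_left:
  assumes "(xs, ys) \<in> fp_rel I G" and zs: "zs \<in> fp_words I G"
  shows "(zs @ xs, zs @ ys) \<in> fp_rel I G"
  using assms(1)
proof induction
  case (unit xs ys u)
  then show ?case using fp_rel.unit[of "zs @ xs" I G ys u] zs by simp
next
  case (mult xs ys u g h)
  then show ?case using fp_rel.mult[of "zs @ xs" I G ys u g h] zs by simp
next
  case (refl xs)
  then show ?case using zs by (simp add: fp_rel.refl)
next
  case (sym xs ys)
  show ?case by (rule fp_rel.sym[OF sym.IH])
next
  case (trans xs ys us)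
  show ?case by (rule fp_rel.trans[OF trans.IH])
qed

lemma fp_rel_append_right:
  assumes "(xs, ys) \<in> fp_rel I G" and zs: "zs \<in> fp_words I G"
  shows "(xs @ zs, ys @ zs) \<in> fp_rel I G"
  using assms(1)
proof induction
  case (unit xs ys u)
  then show ?case using fp_rel.unit[of xs I G "ys @ zs" u] zs by simp
next
  case (mult xs ys u g h)
  then show ?case using fp_rel.mult[of xs I G "ys @ zs" u g h] zs by simp
next
  case (refl xs)
  then show ?case using zs by (simp add: fp_rel.refl)
next
  case (sym xs ys)
  show ?case by (rule fp_rel.sym[OF sym.IH])
next
  case (trans xs ys us)
  show ?case by (rule fp_rel.trans[OF trans.IH])
qed

lemma mult_free_product:
  assumes G: "\<And>u. u \<in> I \<Longrightarrow> group (G u)"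
    and xs: "xs \<in> fp_words I G" and ys: "ys \<in> fp_words I G"
  shows "(fp_rel I G `` {xs}) \<otimes>\<^bsub>free_product I G\<^esub> (fp_rel I G `` {ys}) = fp_rel I G `` {xs @ ys}"
proof -
  note eq = equiv_fp_rel[of I G, OF G]
  have cong: "fp_rel I G `` {x @ y} = fp_rel I G `` {xs @ ys}"
    if "(xs, x) \<in> fp_rel I G" "(ys, y) \<in> fp_rel I G" for x y
  proof -
    have "x \<in> fp_words I G" using fp_rel_words[of I G, OF G that(1)] by auto
    then have "(xs @ ys, x @ y) \<in> fp_rel I G"
      using fp_rel_append_right[OF that(1) ys] fp_rel_append_left[OF that(2)]
      by (blast intro: fp_rel.trans)
    then show ?thesis using equiv_class_eq[OF eq] by blast
  qed
  have "xs \<in> fp_rel I G `` {xs}" "ys \<in> fp_rel I G `` {ys}"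
    using xs ys by (auto intro: fp_rel.refl)
  then have "(\<Union>x \<in> fp_rel I G `` {xs}. \<Union>y \<in> fp_rel I G `` {ys}. fp_rel I G `` {x @ y})
      = fp_rel I G `` {xs @ ys}"
    using cong by blast
  then show ?thesis
    by (simp add: free_product_def)
qed

lemma fp_inverse_word:
  assumes G: "\<And>u. u \<in> I \<Longrightarrow> group (G u)" and "xs \<in> fp_words I G"
  shows "\<exists>ys \<in> fp_words I G. (ys @ xs, []) \<in> fp_rel I G"
  using assms(2)
proof (induction xs)
  case Nil
  then show ?case by (intro bexI[of _ "[]"]) (auto intro: fp_rel.refl)
next
  case (Cons x xs)
  obtain u g where x: "x = (u, g)" by fastforce
  with Cons have u: "u \<in> I" and g: "g \<in> carrier (G u)" and xs: "xs \<in> fp_words I G" by auto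
  interpret Gu: group "G u" by (rule G[OF u])
  obtain ys where ys: "ys \<in> fp_words I G" "(ys @ xs, []) \<in> fp_rel I G"
    using Cons.IH xs by blast
  let ?ys = "ys @ [(u, inv\<^bsub>G u\<^esub> g)]"
  have "(ys @ [(u, inv\<^bsub>G u\<^esub> g), (u, g)] @ xs, ys @ [(u, \<one>\<^bsub>G u\<^esub>)] @ xs) \<in> fp_rel I G"
    using fp_rel.mult[OF ys(1) xs u Gu.inv_closed[OF g] g] g by simp
  then have "(?ys @ x # xs, []) \<in> fp_rel I G"
    using fp_rel.unit[OF ys(1) xs u] ys(2) unfolding x
    by (metis append.assoc append_Cons append_Nil fp_rel.trans)
  then show ?case using ys(1) u g by (intro bexI[of _ ?ys]) auto
qed

lemma group_free_product:
  assumes G: "\<And>u. u \<in> I \<Longrightarrow> group (G u)"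
  shows "group (free_product I G)"
proof (rule groupI)
  note m = mult_free_product[of I G, OF G]
  have carr: "carrier (free_product I G) = fp_words I G // fp_rel I G"
    and one: "\<one>\<^bsub>free_product I G\<^esub> = fp_rel I G `` {[]}"
    by (simp_all add: free_product_def)
  show "x \<otimes>\<^bsub>free_product I G\<^esub> y \<in> carrier (free_product I G)"
    if "x \<in> carrier (free_product I G)" "y \<in> carrier (free_product I G)" for x y
    using that unfolding carr by (auto elim!: quotientE simp: m intro!: quotientI)
  show "\<one>\<^bsub>free_product I G\<^esub> \<in> carrier (free_product I G)"
    unfolding carr one by (auto intro: quotientI)
  show "x \<otimes>\<^bsub>free_product I G\<^esub> y \<otimes>\<^bsub>free_product I G\<^esub> z
      = x \<otimes>\<^bsub>free_product I G\<^esub> (y \<otimes>\<^bsub>free_product I G\<^esub> z)"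
    if "x \<in> carrier (free_product I G)" "y \<in> carrier (free_product I G)"
      "z \<in> carrier (free_product I G)" for x y z
    using that unfolding carr by (auto elim!: quotientE simp: m)
  show "\<one>\<^bsub>free_product I G\<^esub> \<otimes>\<^bsub>free_product I G\<^esub> x = x"
    if "x \<in> carrier (free_product I G)" for x
    using that unfolding carr one by (auto elim!: quotientE simp: m)
  show "\<exists>y\<in>carrier (free_product I G). y \<otimes>\<^bsub>free_product I G\<^esub> x = \<one>\<^bsub>free_product I G\<^esub>"
    if x: "x \<in> carrier (free_product I G)" for x
  proof -
    obtain xs where xs: "xs \<in> fp_words I G" "x = fp_rel I G `` {xs}"
      using x unfolding carr by (blast elim: quotientE)
    obtain ys where ys: "ys \<in> fp_words I G" "(ys @ xs, []) \<in> fp_rel I G"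
      using fp_inverse_word[OF G xs(1)] by blast
    then have "fp_rel I G `` {ys} \<otimes>\<^bsub>free_product I G\<^esub> x = \<one>\<^bsub>free_product I G\<^esub>"
      using equiv_class_eq[OF equiv_fp_rel[of I G, OF G]] by (simp add: xs m one)
    then show ?thesis unfolding carr using ys(1) by (blast intro: quotientI)
  qed
qed

lemma (in group) normal_normal_closure:
  assumes S: "S \<subseteq> carrier G"
  shows "normal_closure G S \<lhd> G"
proof -
  have top: "carrier G \<lhd> G"
    by (rule normal_invI) (auto simp: subgroup_self)
  show ?thesis
  proof (rule normal_invI)
    show "subgroup (normal_closure G S) G"
      unfolding normal_closure_def hull_def
      using top S by (intro subgroups_Inter) (auto dest: normal_imp_subgroup)
    show "x \<otimes> h \<otimes> inv x \<in> normal_closure G S"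
      if "x \<in> carrier G" "h \<in> normal_closure G S" for x h
      using that unfolding normal_closure_def hull_def by (auto intro: normal.inv_op_closed2)
  qed
qed

lemma group_graph_product:
  assumes "pair_graph \<Gamma>" and G: "\<And>u. u \<in> pverts \<Gamma> \<Longrightarrow> group (G u)"
  shows "group (graph_product \<Gamma> G)"
proof -
  interpret \<Gamma>: pair_graph \<Gamma> by fact
  interpret F: group "free_product (pverts \<Gamma>) G" by (rule group_free_product[OF G])
  have incl: "fp_incl (pverts \<Gamma>) G u g \<in> carrier (free_product (pverts \<Gamma>) G)"
    if "u \<in> pverts \<Gamma>" "g \<in> carrier (G u)" for u g
    using that by (auto simp: free_product_def fp_incl_def intro!: quotientI)
  have "gp_relators \<Gamma> G \<subseteq> carrier (free_product (pverts \<Gamma>) G)"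
    by (auto simp: gp_relators_def commutator_def intro!: incl dest: \<Gamma>.wellformed')
  then show ?thesis
    unfolding graph_product_def
    by (intro normal.factorgroup_is_group F.normal_normal_closure)
qed

end

theory Submission
  imports Defs "HOL-Algebra.Multiplicative_Group"
begin

text \<open>
  Let P be the graph product, call a vertex a cone vertex if it is joined to every other vertex,
  and let P_U denote the subgroup generated by the vertex groups of the vertices in U. With D the
  set of cone vertices, P_D is central, because the vertex groups are abelian. The theorem follows
  from two stronger facts: P_D is the whole centre (centre_eq), and every element n of a finite
  normal subgroup N of Aut P is a central automorphism, n g = f g * g for a homomorphism f from P
  to P_D (finite_normal_autos_displacement).

  Both facts come from one action. Fix a vertex v that is not a cone vertex. The kernel of the
  retraction of P that kills G_v is a free product of copies of G_v, one for each coset of the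
  subgroup L generated by the link of v in P_(V - v). So P acts on reduced words over these
  copies: G_v multiplies on the left by letters of the copy at L, and the other vertex groups
  translate the cosets. An element that fixes the empty word lies in P_(V - v) (nf_Nil). As v is
  not a cone vertex, there are at least two copies, hence a letter can be put in front of any
  given word without cancellation. Comparing lengths, a central element fixes the empty word
  (central_nf), and so does each element of a normal subgroup in which the lengths of the words
  are bounded, since an element of maximal length could be squared or conjugated to a longer one
  (bounded_normal_nf). An element which lies in P_(V - v) for all such v lies in P_D; this gives
  the centre. For a finite normal N in Aut P, the elements x of P whose inner automorphism lies in
  N form a normal subgroup with bounded lengths, because the word of x depends on the inner
  automorphism only. Hence these x are central, and they include all n g * g^-1.

  It remains to look at the homomorphism f, unless P has order 2 and so has no nontrivial
  automorphisms. The homomorphism is trivial if there are no cone vertices. If P_D has order 2 and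
  all other vertex groups have odd order, then f kills the other vertex groups, and an
  automorphism can only fix the two elements of the centre. If P_D is free abelian and G_w is
  infinite cyclic for some w outside D, with generator t, then n commutes with the transvections t
  |-> a t for a in P_D, since the commutator lies in N and fixes the centre pointwise; comparing
  both orders of composition at t gives n a = a. Then the powers of n displace by the powers of f,
  which are distinct unless f is trivial; as N is finite, n is the identity.

  For the converse, suppose that there are cone vertices. If P_D is free abelian and nontrivial
  and all other vertex groups are finite, the automorphism that inverts the centre and fixes P_(V
  - D) is central in Aut P. If some cone vertex v has a finite group, consider the automorphisms
  that are trivial modulo the torsion of the centre. They form a finite normal subgroup. It
  contains the inversion of G_v, and a transvection along every homomorphism from another vertex
  group to G_v. So if it is trivial, then G_v has order 2 and all other vertex groups have odd
  order, which leaves only the cases (ii) and (iii).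
\<close>

section \<open>Centre, automorphisms and cyclic groups\<close>

context group
begin

definition centre where "centre = {z \<in> carrier G. \<forall>y\<in>carrier G. z \<otimes> y = y \<otimes> z}"

lemma centreI: "z \<in> carrier G \<Longrightarrow> (\<And>y. y \<in> carrier G \<Longrightarrow> z \<otimes> y = y \<otimes> z) \<Longrightarrow> z \<in> centre"
  unfolding centre_def by blast

lemma centre_closed [simp]: "z \<in> centre \<Longrightarrow> z \<in> carrier G"
  unfolding centre_def by blast

lemma centre_commute: "z \<in> centre \<Longrightarrow> y \<in> carrier G \<Longrightarrow> z \<otimes> y = y \<otimes> z"
  unfolding centre_def by blast

lemma subgroup_centre: "subgroup centre G"
proof (rule subgroupI)
  show "inv z \<in> centre" if z: "z \<in> centre" for z
  proof (rule centreI)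
    show "inv z \<otimes> y = y \<otimes> inv z" if y: "y \<in> carrier G" for y
    proof -
      have "inv z \<otimes> y = inv z \<otimes> (y \<otimes> z) \<otimes> inv z" using y centre_closed[OF z] by (simp add: m_assoc)
      also have "\<dots> = inv z \<otimes> (z \<otimes> y) \<otimes> inv z" by (simp only: centre_commute[OF z y])
      also have "\<dots> = y \<otimes> inv z" using y centre_closed[OF z] by (simp flip: m_assoc)
      finally show ?thesis .
    qed
    show "inv z \<in> carrier G" using centre_closed[OF z] by simp
  qed
  show "a \<otimes> b \<in> centre" if ab: "a \<in> centre" "b \<in> centre" for a b
  proof (rule centreI)
    show "a \<otimes> b \<otimes> y = y \<otimes> (a \<otimes> b)" if y: "y \<in> carrier G" for y
    proof -
      note cl = centre_closed[OF ab(1)] centre_closed[OF ab(2)] y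
      have "a \<otimes> b \<otimes> y = a \<otimes> (b \<otimes> y)" using cl by (simp add: m_assoc)
      also have "\<dots> = a \<otimes> (y \<otimes> b)" by (simp only: centre_commute[OF ab(2) y])
      also have "\<dots> = a \<otimes> y \<otimes> b" using cl by (simp add: m_assoc)
      also have "\<dots> = y \<otimes> a \<otimes> b" by (simp only: centre_commute[OF ab(1) y])
      finally show ?thesis using cl by (simp add: m_assoc)
    qed
    show "a \<otimes> b \<in> carrier G" using ab by simp
  qed
next
  show "centre \<subseteq> carrier G" by (rule subsetI) simp
  have "\<one> \<in> centre" by (rule centreI) simp_all
  then show "centre \<noteq> {}" by blast
qed

text \<open>
  Pointwise products of homomorphisms are homomorphisms as soon as one factor is central. The
  transvections and flips below are built from such products.
\<close>

lemma hom_mult_centre: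
  assumes f: "f \<in> hom T G" and g: "g \<in> hom T G" and c: "\<And>x. x \<in> carrier T \<Longrightarrow> f x \<in> centre"
  shows "(\<lambda>x. f x \<otimes> g x) \<in> hom T G"
proof (rule homI)
  show "f x \<otimes> g x \<in> carrier G" if "x \<in> carrier T" for x
    using that f g by (auto simp: hom_def)
  show "f (x \<otimes>\<^bsub>T\<^esub> y) \<otimes> g (x \<otimes>\<^bsub>T\<^esub> y) = f x \<otimes> g x \<otimes> (f y \<otimes> g y)"
    if xy: "x \<in> carrier T" "y \<in> carrier T" for x y
  proof -
    have cl: "f x \<in> carrier G" "f y \<in> carrier G" "g x \<in> carrier G" "g y \<in> carrier G"
      using xy f g by (auto simp: hom_def)
    have "f x \<otimes> (f y \<otimes> g x) \<otimes> g y = f x \<otimes> (g x \<otimes> f y) \<otimes> g y"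
      by (simp only: centre_commute[OF c[OF xy(2)] cl(3)])
    then show ?thesis using xy cl hom_mult[OF f] hom_mult[OF g] by (simp add: m_assoc)
  qed
qed

lemma hom_inv_centre:
  assumes f: "f \<in> hom T G" and c: "\<And>x. x \<in> carrier T \<Longrightarrow> f x \<in> centre"
  shows "(\<lambda>x. inv (f x)) \<in> hom T G"
proof (rule homI)
  show "inv f x \<in> carrier G" if "x \<in> carrier T" for x
    using that f by (auto simp: hom_def)
  show "inv f (x \<otimes>\<^bsub>T\<^esub> y) = inv f x \<otimes> inv f y"
    if xy: "x \<in> carrier T" "y \<in> carrier T" for x y
    using hom_mult[OF f xy] c[OF xy(1)] c[OF xy(2)]
      centre_commute[OF subgroup.m_inv_closed[OF subgroup_centre c[OF xy(2)]], of "inv f x"]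
    by (simp add: inv_mult_group)
qed

lemma carrier_AutoGroup [simp]: "carrier (AutoGroup G) = auto G"
  by (simp add: AutoGroup_def)

lemma auto_hom: "\<alpha> \<in> auto G \<Longrightarrow> \<alpha> \<in> hom G G"
  by (simp add: auto_def)

lemma auto_closed [simp]: "\<alpha> \<in> auto G \<Longrightarrow> x \<in> carrier G \<Longrightarrow> \<alpha> x \<in> carrier G"
  by (auto simp: auto_def hom_def)

lemma auto_inj: "\<alpha> \<in> auto G \<Longrightarrow> x \<in> carrier G \<Longrightarrow> y \<in> carrier G \<Longrightarrow> \<alpha> x = \<alpha> y \<Longrightarrow> x = y"
  by (auto simp: auto_def Bij_def bij_betw_def dest: inj_onD)

lemma auto_group_hom: "\<alpha> \<in> auto G \<Longrightarrow> group_hom G G \<alpha>"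
  by unfold_locales (rule auto_hom)

lemma AutoGroup_mult:
  "\<alpha> \<in> auto G \<Longrightarrow> \<beta> \<in> auto G \<Longrightarrow> x \<in> carrier G \<Longrightarrow> (\<alpha> \<otimes>\<^bsub>AutoGroup G\<^esub> \<beta>) x = \<alpha> (\<beta> x)"
  by (auto simp: AutoGroup_def BijGroup_def auto_def compose_def)

lemma AutoGroup_one: "x \<in> carrier G \<Longrightarrow> \<one>\<^bsub>AutoGroup G\<^esub> x = x"
  by (simp add: AutoGroup_def BijGroup_def)

lemma auto_eqI:
  "\<alpha> \<in> auto G \<Longrightarrow> \<beta> \<in> auto G \<Longrightarrow> (\<And>x. x \<in> carrier G \<Longrightarrow> \<alpha> x = \<beta> x) \<Longrightarrow> \<alpha> = \<beta>"
  by (rule extensionalityI[where A = "carrier G"]) (auto simp: auto_def Bij_def)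

lemma one_auto [simp]: "\<one>\<^bsub>AutoGroup G\<^esub> \<in> auto G"
  using id_in_auto by (simp add: AutoGroup_def BijGroup_def)

lemma auto_eq_one: "\<alpha> \<in> auto G \<Longrightarrow> (\<And>x. x \<in> carrier G \<Longrightarrow> \<alpha> x = x) \<Longrightarrow> \<alpha> = \<one>\<^bsub>AutoGroup G\<^esub>"
  by (intro auto_eqI) (simp_all add: AutoGroup_one)

lemma inv_auto [simp]: "\<alpha> \<in> auto G \<Longrightarrow> inv\<^bsub>AutoGroup G\<^esub> \<alpha> \<in> auto G"
  using group.inv_closed[OF AutoGroup, of \<alpha>] by simp

lemma mult_auto [simp]: "\<alpha> \<in> auto G \<Longrightarrow> \<beta> \<in> auto G \<Longrightarrow> \<alpha> \<otimes>\<^bsub>AutoGroup G\<^esub> \<beta> \<in> auto G"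
  using monoid.m_closed[OF group.is_monoid[OF AutoGroup], of \<alpha> \<beta>] by simp

lemma inv_auto_left: "\<alpha> \<in> auto G \<Longrightarrow> x \<in> carrier G \<Longrightarrow> (inv\<^bsub>AutoGroup G\<^esub> \<alpha>) (\<alpha> x) = x"
  using group.l_inv[OF AutoGroup, of \<alpha>] AutoGroup_mult[of "inv\<^bsub>AutoGroup G\<^esub> \<alpha>" \<alpha> x]
  by (simp add: AutoGroup_one)

lemma inv_auto_right: "\<alpha> \<in> auto G \<Longrightarrow> x \<in> carrier G \<Longrightarrow> \<alpha> ((inv\<^bsub>AutoGroup G\<^esub> \<alpha>) x) = x"
  using group.r_inv[OF AutoGroup, of \<alpha>] AutoGroup_mult[of \<alpha> "inv\<^bsub>AutoGroup G\<^esub> \<alpha>" x]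
  by (simp add: AutoGroup_one)

lemma autoI:
  assumes h: "h \<in> hom G G" and k: "\<And>x. x \<in> carrier G \<Longrightarrow> k x \<in> carrier G"
    and "\<And>x. x \<in> carrier G \<Longrightarrow> h (k x) = x" "\<And>x. x \<in> carrier G \<Longrightarrow> k (h x) = x"
  shows "restrict h (carrier G) \<in> auto G"
proof -
  have "h x \<in> carrier G" if "x \<in> carrier G" for x using h that by (auto simp: hom_def)
  then have "bij_betw (restrict h (carrier G)) (carrier G) (carrier G)"
    using assms by (intro bij_betw_byWitness[where f' = k]) auto
  moreover have "restrict h (carrier G) \<in> hom G G" using h by (auto simp: hom_def)
  ultimately show ?thesis by (simp add: auto_def Bij_def)
qed

text \<open>
  If f kills its own image, then x |-> (f x)^-1 x inverts x |-> f x * x.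
\<close>

lemma transvection_auto:
  assumes f: "f \<in> hom G G" and c: "\<And>x. x \<in> carrier G \<Longrightarrow> f x \<in> centre"
    and ff: "\<And>x. x \<in> carrier G \<Longrightarrow> f (f x) = \<one>"
  shows "(\<lambda>x\<in>carrier G. f x \<otimes> x) \<in> auto G"
proof (rule autoI[where k = "\<lambda>x. inv (f x) \<otimes> x"])
  interpret f: group_hom G G f using f by unfold_locales
  show "(\<lambda>x. f x \<otimes> x) \<in> hom G G"
    using hom_mult_centre[OF f _ c, of "\<lambda>x. x"] by (simp add: hom_def)
  show "f (inv f x \<otimes> x) \<otimes> (inv f x \<otimes> x) = x" if "x \<in> carrier G" for x
    using that ff by (simp flip: m_assoc)
  show "inv f (f x \<otimes> x) \<otimes> (f x \<otimes> x) = x" if "x \<in> carrier G" for x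
    using that ff by (simp flip: m_assoc)
qed (use f in \<open>auto simp: hom_def\<close>)

text \<open>
  A converse to the construction of automorphisms by central factors: an endomorphism which moves
  all elements by central factors is of that form.
\<close>

lemma displacement_hom:
  assumes \<alpha>: "\<alpha> \<in> hom G G" and c: "\<And>x. x \<in> carrier G \<Longrightarrow> \<alpha> x \<otimes> inv x \<in> centre"
  shows "(\<lambda>x. \<alpha> x \<otimes> inv x) \<in> hom G G"
proof (rule homI)
  interpret \<alpha>: group_hom G G \<alpha> using \<alpha> by unfold_locales
  show "\<alpha> (x \<otimes> y) \<otimes> inv (x \<otimes> y) = \<alpha> x \<otimes> inv x \<otimes> (\<alpha> y \<otimes> inv y)"
    if xy: "x \<in> carrier G" "y \<in> carrier G" for x y
  proof -
    have "\<alpha> x \<otimes> ((\<alpha> y \<otimes> inv y) \<otimes> inv x) = \<alpha> x \<otimes> (inv x \<otimes> (\<alpha> y \<otimes> inv y))"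
      using centre_commute[OF c[OF xy(2)], of "inv x"] xy by simp
    then show ?thesis using xy by (simp add: inv_mult_group m_assoc)
  qed
qed (use \<alpha> in \<open>auto simp: hom_def\<close>)

lemma auto_centre:
  assumes \<alpha>: "\<alpha> \<in> auto G" and z: "z \<in> centre"
  shows "\<alpha> z \<in> centre"
proof (rule centreI)
  interpret \<alpha>: group_hom G G \<alpha> by (rule auto_group_hom[OF \<alpha>])
  show "\<alpha> z \<otimes> y = y \<otimes> \<alpha> z" if y: "y \<in> carrier G" for y
  proof -
    let ?y = "(inv\<^bsub>AutoGroup G\<^esub> \<alpha>) y"
    have "?y \<in> carrier G" "\<alpha> ?y = y" using \<alpha> y by (simp_all add: inv_auto_right)
    then show ?thesis
      using z centre_commute[OF z, of ?y] \<alpha>.hom_mult[of z ?y] \<alpha>.hom_mult[of ?y z] by simp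
  qed
qed (use assms in simp)

definition inner where "inner x = (\<lambda>y\<in>carrier G. x \<otimes> y \<otimes> inv x)"

lemma inner_auto: 
  assumes x: "x \<in> carrier G" shows "inner x \<in> auto G"
  unfolding inner_def
proof (rule autoI[where k = "\<lambda>y. inv x \<otimes> y \<otimes> x"])
  have *: "x \<otimes> (inv x \<otimes> y) = y" "inv x \<otimes> (x \<otimes> y) = y" if "y \<in> carrier G" for y
    using x that by (simp_all flip: m_assoc)
  show "(\<lambda>y. x \<otimes> y \<otimes> inv x) \<in> hom G G"
    using x by (auto simp: hom_def m_assoc *)
  show "x \<otimes> (inv x \<otimes> y \<otimes> x) \<otimes> inv x = y" "inv x \<otimes> (x \<otimes> y \<otimes> inv x) \<otimes> x = y" if "y \<in> carrier G" for y
    using x that by (simp_all add: m_assoc *)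
qed (use x in simp)

lemma inner_hom: "inner \<in> hom G (AutoGroup G)"
proof (rule homI)
  show "inner (x \<otimes> y) = inner x \<otimes>\<^bsub>AutoGroup G\<^esub> inner y" if "x \<in> carrier G" "y \<in> carrier G" for x y
    using that
    by (intro auto_eqI) (auto simp: inner_auto AutoGroup_mult, auto simp: inner_def inv_mult_group m_assoc)
qed (simp add: inner_auto)

lemma conj_inner:
  assumes \<alpha>: "\<alpha> \<in> auto G" and x: "x \<in> carrier G"
  shows "\<alpha> \<otimes>\<^bsub>AutoGroup G\<^esub> inner x \<otimes>\<^bsub>AutoGroup G\<^esub> inv\<^bsub>AutoGroup G\<^esub> \<alpha> = inner (\<alpha> x)"
proof (rule auto_eqI)
  interpret \<alpha>: group_hom G G \<alpha> by (rule auto_group_hom[OF \<alpha>])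
  fix y assume y: "y \<in> carrier G"
  let ?y = "(inv\<^bsub>AutoGroup G\<^esub> \<alpha>) y"
  have y': "?y \<in> carrier G" "\<alpha> ?y = y" using \<alpha> y by (simp_all add: inv_auto_right)
  then show "(\<alpha> \<otimes>\<^bsub>AutoGroup G\<^esub> inner x \<otimes>\<^bsub>AutoGroup G\<^esub> inv\<^bsub>AutoGroup G\<^esub> \<alpha>) y = inner (\<alpha> x) y"
    using \<alpha> x y by (simp add: AutoGroup_mult inner_auto) (simp add: inner_def)
qed (use assms in \<open>simp_all add: inner_auto\<close>)

lemma inner_eq_centre:
  assumes xy: "x \<in> carrier G" "y \<in> carrier G" and eq: "inner x = inner y"
  shows "inv x \<otimes> y \<in> centre"
proof (rule centreI)
  show "inv x \<otimes> y \<otimes> z = z \<otimes> (inv x \<otimes> y)" if z: "z \<in> carrier G" for z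
  proof -
    have "x \<otimes> z \<otimes> inv x = y \<otimes> z \<otimes> inv y"
      using fun_cong[OF eq, of z] z by (simp add: inner_def)
    then have "inv x \<otimes> (x \<otimes> z \<otimes> inv x) \<otimes> y = inv x \<otimes> (y \<otimes> z \<otimes> inv y) \<otimes> y" by simp
    moreover have "inv x \<otimes> (x \<otimes> z \<otimes> inv x) \<otimes> y = (inv x \<otimes> x) \<otimes> z \<otimes> (inv x \<otimes> y)"
      using xy z by (simp only: m_assoc m_closed inv_closed)
    moreover have "inv x \<otimes> (y \<otimes> z \<otimes> inv y) \<otimes> y = inv x \<otimes> y \<otimes> z \<otimes> (inv y \<otimes> y)"
      using xy z by (simp only: m_assoc m_closed inv_closed)
    ultimately show ?thesis using xy z by simp
  qed
qed (use xy in simp)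

lemma normal_inner_vimage:
  assumes "N \<lhd> AutoGroup G"
  shows "{x \<in> carrier G. inner x \<in> N} \<lhd> G"
proof -
  interpret N: normal N "AutoGroup G" by fact
  interpret inner: group_hom G "AutoGroup G" inner
    using inner_hom AutoGroup by (simp add: group_hom_def group_hom_axioms_def)
  show ?thesis
  proof (rule normal_invI)
    show "subgroup {x \<in> carrier G. inner x \<in> N} G"
      by (rule subgroupI) (auto intro: exI[of _ \<one>])
    show "x \<otimes> h \<otimes> inv x \<in> {x \<in> carrier G. inner x \<in> N}"
      if "x \<in> carrier G" "h \<in> {x \<in> carrier G. inner x \<in> N}" for x h
      using that N.inv_op_closed2[of "inner x" "inner h"] by (simp add: inner_auto)
  qed
qed

text \<open>
  The inner automorphism of n x * x^-1 is the commutator of n with the inner automorphism of x,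
  and therefore lies in every normal subgroup that contains n.
\<close>

lemma inner_displacement:
  assumes "N \<lhd> AutoGroup G" and n: "n \<in> N" and x: "x \<in> carrier G"
  shows "inner (n x \<otimes> inv x) \<in> N"
proof -
  interpret N: normal N "AutoGroup G" by fact
  interpret inner: group_hom G "AutoGroup G" inner
    using inner_hom AutoGroup by (simp add: group_hom_def group_hom_axioms_def)
  interpret A: group "AutoGroup G" by (rule AutoGroup)
  have n': "n \<in> auto G" using N.mem_carrier[OF n] by simp
  have "n \<otimes>\<^bsub>AutoGroup G\<^esub> (inner x \<otimes>\<^bsub>AutoGroup G\<^esub> inv\<^bsub>AutoGroup G\<^esub> n \<otimes>\<^bsub>AutoGroup G\<^esub> inv\<^bsub>AutoGroup G\<^esub> (inner x)) \<in> N"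
    using N.inv_op_closed2[of "inner x" "inv\<^bsub>AutoGroup G\<^esub> n"] n x by (simp add: inner_auto)
  also have "n \<otimes>\<^bsub>AutoGroup G\<^esub> (inner x \<otimes>\<^bsub>AutoGroup G\<^esub> inv\<^bsub>AutoGroup G\<^esub> n \<otimes>\<^bsub>AutoGroup G\<^esub> inv\<^bsub>AutoGroup G\<^esub> (inner x))
      = inner (n x) \<otimes>\<^bsub>AutoGroup G\<^esub> inv\<^bsub>AutoGroup G\<^esub> (inner x)"
    using n' x by (simp add: inner_auto group.is_monoid[OF AutoGroup, THEN monoid.m_assoc] flip: conj_inner)
  also have "\<dots> = inner (n x \<otimes> inv x)" using n' x by simp
  finally show ?thesis .
qed

definition torsion_centre where
  "torsion_centre = {z \<in> centre. \<exists>j>0::nat. z [^] j = \<one>}"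

lemma subgroup_torsion_centre: "subgroup torsion_centre G"
proof (rule subgroupI)
  interpret Z: subgroup centre G by (rule subgroup_centre)
  show "torsion_centre \<subseteq> carrier G" by (auto simp: torsion_centre_def)
  have "\<one> \<in> torsion_centre" by (auto simp: torsion_centre_def intro!: exI[of _ 1])
  then show "torsion_centre \<noteq> {}" by auto
  show "inv a \<in> torsion_centre" if "a \<in> torsion_centre" for a
    using that by (auto simp: torsion_centre_def nat_pow_inv intro!: exI)
  show "a \<otimes> b \<in> torsion_centre" if ab: "a \<in> torsion_centre" "b \<in> torsion_centre" for a b
  proof -
    obtain i j :: nat where ij: "i > 0" "j > 0" "a [^] i = \<one>" "b [^] j = \<one>" "a \<in> centre" "b \<in> centre"
      using ab by (auto simp: torsion_centre_def)
    have "a [^] (i * j) = (a [^] i) [^] j" "b [^] (i * j) = (b [^] j) [^] i"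
      using nat_pow_pow[OF centre_closed[OF ij(5)], of i j] nat_pow_pow[OF centre_closed[OF ij(6)], of j i]
      by (metis mult.commute)+
    then have "a [^] (i * j) = \<one>" "b [^] (i * j) = \<one>"
      by (simp_all only: ij nat_pow_one)
    then have "(a \<otimes> b) [^] (i * j) = \<one>"
      using ij pow_mult_distrib[OF centre_commute[OF ij(5)], of b "i * j"] by simp
    then show ?thesis using ij by (auto simp: torsion_centre_def intro!: exI[of _ "i * j"])
  qed
qed

lemma auto_torsion_centre:
  assumes "\<alpha> \<in> auto G" "z \<in> torsion_centre"
  shows "\<alpha> z \<in> torsion_centre"
proof -
  interpret \<alpha>: group_hom G G \<alpha> by (rule auto_group_hom[OF assms(1)])
  obtain j :: nat where "j > 0" "z [^] j = \<one>" "z \<in> centre"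
    using assms(2) by (auto simp: torsion_centre_def)
  then have "\<alpha> z [^] j = \<one>" using \<alpha>.hom_nat_pow[of z j] by simp
  then show ?thesis
    using \<open>j > 0\<close> \<open>z \<in> centre\<close> auto_centre[OF assms(1)] by (auto simp: torsion_centre_def)
qed

text \<open>
  The automorphisms that induce the identity modulo the torsion subgroup of the centre. That
  subgroup is characteristic, hence they form a normal subgroup of the automorphism group.
\<close>

definition torsion_autos where
  "torsion_autos = {\<alpha> \<in> auto G. \<forall>x\<in>carrier G. \<alpha> x \<otimes> inv x \<in> torsion_centre}"

lemma normal_torsion_autos: "torsion_autos \<lhd> AutoGroup G"
proof (rule group.normal_invI[OF AutoGroup])
  interpret T: subgroup torsion_centre G by (rule subgroup_torsion_centre)
  interpret A: group "AutoGroup G" by (rule AutoGroup)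
  show "subgroup torsion_autos (AutoGroup G)"
  proof (rule A.subgroupI)
    show "torsion_autos \<subseteq> carrier (AutoGroup G)" by (auto simp: torsion_autos_def)
    have "\<one>\<^bsub>AutoGroup G\<^esub> \<in> torsion_autos"
      using A.one_closed by (auto simp: torsion_autos_def AutoGroup_one)
    then show "torsion_autos \<noteq> {}" by auto
    show "inv\<^bsub>AutoGroup G\<^esub> \<alpha> \<in> torsion_autos" if \<alpha>: "\<alpha> \<in> torsion_autos" for \<alpha>
    proof -
      have "(inv\<^bsub>AutoGroup G\<^esub> \<alpha>) x \<otimes> inv x \<in> torsion_centre" if x: "x \<in> carrier G" for x
      proof -
        let ?y = "(inv\<^bsub>AutoGroup G\<^esub> \<alpha>) x"
        have "\<alpha> \<in> auto G" using \<alpha> by (simp add: torsion_autos_def)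
        then have y: "?y \<in> carrier G" "\<alpha> ?y = x" using x by (simp_all add: inv_auto_right)
        then have "inv (\<alpha> ?y \<otimes> inv ?y) \<in> torsion_centre" using \<alpha> by (auto simp: torsion_autos_def)
        then show ?thesis using x y by (simp add: inv_mult_group)
      qed
      then show ?thesis using \<alpha> by (simp add: torsion_autos_def)
    qed
    show "\<alpha> \<otimes>\<^bsub>AutoGroup G\<^esub> \<beta> \<in> torsion_autos"
      if \<alpha>\<beta>: "\<alpha> \<in> torsion_autos" "\<beta> \<in> torsion_autos" for \<alpha> \<beta>
    proof -
      have ab: "\<alpha> \<in> auto G" "\<beta> \<in> auto G" using \<alpha>\<beta> by (simp_all add: torsion_autos_def)
      have "\<alpha> (\<beta> x) \<otimes> inv x \<in> torsion_centre" if x: "x \<in> carrier G" for x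
      proof -
        have "(\<alpha> (\<beta> x) \<otimes> inv (\<beta> x)) \<otimes> (\<beta> x \<otimes> inv x) \<in> torsion_centre"
          using \<alpha>\<beta> ab x by (simp add: torsion_autos_def)
        also have "(\<alpha> (\<beta> x) \<otimes> inv (\<beta> x)) \<otimes> (\<beta> x \<otimes> inv x) = \<alpha> (\<beta> x) \<otimes> (inv (\<beta> x) \<otimes> \<beta> x) \<otimes> inv x"
          using ab x by (simp only: m_assoc auto_closed inv_closed m_closed)
        finally show ?thesis using ab x by simp
      qed
      then show ?thesis using ab by (simp add: torsion_autos_def AutoGroup_mult)
    qed
  qed
  show "\<beta> \<otimes>\<^bsub>AutoGroup G\<^esub> \<alpha> \<otimes>\<^bsub>AutoGroup G\<^esub> inv\<^bsub>AutoGroup G\<^esub> \<beta> \<in> torsion_autos"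
    if \<beta>: "\<beta> \<in> carrier (AutoGroup G)" and \<alpha>: "\<alpha> \<in> torsion_autos" for \<beta> \<alpha>
  proof -
    have ab: "\<alpha> \<in> auto G" "\<beta> \<in> auto G" using \<alpha> \<beta> by (simp_all add: torsion_autos_def)
    interpret \<beta>: group_hom G G \<beta> by (rule auto_group_hom[OF ab(2)])
    have "\<beta> (\<alpha> ((inv\<^bsub>AutoGroup G\<^esub> \<beta>) x)) \<otimes> inv x \<in> torsion_centre" if x: "x \<in> carrier G" for x
    proof -
      let ?y = "(inv\<^bsub>AutoGroup G\<^esub> \<beta>) x"
      have y: "?y \<in> carrier G" "\<beta> ?y = x" using ab x by (simp_all add: inv_auto_right)
      then show ?thesis
        using auto_torsion_centre[OF ab(2), of "\<alpha> ?y \<otimes> inv ?y"] \<alpha> ab by (simp add: torsion_autos_def)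
    qed
    then show ?thesis using ab by (simp add: torsion_autos_def AutoGroup_mult)
  qed
qed

lemma order_two_carrier:
  assumes "card (carrier G) = 2"
  obtains s where "carrier G = {\<one>, s}" "s \<noteq> \<one>"
proof -
  have "card (carrier G - {\<one>}) = 1" using assms by (simp add: card_Diff_singleton)
  then obtain s where "carrier G - {\<one>} = {s}" by (rule card_1_singletonE)
  then have "carrier G = {\<one>, s}" "s \<noteq> \<one>" using one_closed by blast+
  then show thesis by (rule that)
qed

lemma auto_of_order_two_trivial:
  assumes card: "card (carrier G) = 2" and \<alpha>: "\<alpha> \<in> auto G"
  shows "\<alpha> = \<one>\<^bsub>AutoGroup G\<^esub>"
proof (rule auto_eq_one[OF \<alpha>])
  interpret \<alpha>: group_hom G G \<alpha> by (rule auto_group_hom[OF \<alpha>])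
  obtain s where s: "carrier G = {\<one>, s}" "s \<noteq> \<one>" by (rule order_two_carrier[OF card])
  have "\<alpha> s \<noteq> \<one>" using auto_inj[OF \<alpha>, of s \<one>] s by auto
  moreover have "\<alpha> s \<in> {\<one>, s}" using \<alpha>.hom_closed[of s] s(1) by blast
  ultimately show "\<alpha> x = x" if "x \<in> carrier G" for x using that s(1) by auto
qed

lemma cyclic_generator:
  assumes "cyclic_group G"
  obtains t where "t \<in> carrier G" "carrier G = range (\<lambda>n::int. t [^] n)"
  using assms by (auto simp: cyclic_group)

lemma cyclic_generator_ord:
  assumes t: "t \<in> carrier G" "carrier G = range (\<lambda>n::int. t [^] n)"
  shows "finite (carrier G) \<longleftrightarrow> ord t \<noteq> 0" "order G = ord t"
proof -
  have "carrier (subgroup_generated G {t}) = carrier G"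
    using t(2) by (simp add: carrier_subgroup_generated_by_singleton[OF t(1)])
  then show *: "finite (carrier G) \<longleftrightarrow> ord t \<noteq> 0"
    using finite_cyclic_subgroup_order[OF t(1)] by simp
  show "order G = ord t"
    using t by (simp add: order_def generate_pow generate_pow_card[OF t(1)] full_SetCompr_eq)
qed

lemma infinite_cyclic_iso:
  assumes "cyclic_group G" "infinite (carrier G)"
  shows "G \<cong> integer_group"
proof -
  obtain t where t: "t \<in> carrier G" "carrier G = range (\<lambda>n::int. t [^] n)"
    using cyclic_generator[OF assms(1)] by blast
  then have "inj (\<lambda>n::int. t [^] n)"
    using cyclic_generator_ord[OF t] assms(2) by (auto simp: inj_def int_pow_eq)
  then have "(\<lambda>n::int. t [^] n) \<in> iso integer_group G"
    using hom_integer_group_pow[OF t(1)] t(2) by (auto simp: iso_def bij_betw_def)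
  then show ?thesis using group.iso_sym[OF group_integer_group] is_isoI by blast
qed

lemma order_two_iso:
  assumes "card (carrier G) = 2"
  shows "G \<cong> integer_mod_group 2"
proof -
  obtain s where s: "carrier G = {\<one>, s}" "s \<noteq> \<one>" by (rule order_two_carrier[OF assms])
  have ss: "s \<otimes> s = \<one>"
    using s m_closed[of s s] l_cancel_one[of s s] by auto
  have carr: "carrier (integer_mod_group 2) = {0, 1}"
    by (auto simp: carrier_integer_mod_group)
  have "(\<lambda>x. if x = \<one> then 0 else 1) \<in> iso G (integer_mod_group 2)"
    using s ss by (auto simp: iso_def hom_def bij_betw_def inj_on_def carr)
  then show ?thesis by (rule is_isoI)
qed

lemma infinite_cyclic_torsion_free:
  assumes "cyclic_group G" "infinite (carrier G)" and x: "x \<in> carrier G"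
    and "x [^] (j::nat) = \<one>" "j > 0"
  shows "x = \<one>"
proof -
  obtain t where t: "t \<in> carrier G" "carrier G = range (\<lambda>n::int. t [^] n)"
    by (rule cyclic_generator[OF assms(1)])
  have ord: "ord t = 0" using cyclic_generator_ord[OF t] assms(2) by simp
  obtain i :: int where i: "x = t [^] i" using x unfolding t(2) by blast
  have "t [^] (i * int j) = \<one>"
    using assms(4) int_pow_pow[OF t(1), of i "int j"] unfolding i by (simp add: int_pow_int)
  then have "i * int j = 0" using int_pow_eq_id[OF t(1), of "i * int j"] ord by simp
  then show ?thesis using i assms(5) by simp
qed

text \<open>
  A cyclic group is presented by its generator and the single relation on the exponents, so a
  homomorphism may be prescribed on the generator. The choice of exponents below is harmless
  because two exponents of the same element differ by a relation.
\<close>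

lemma cyclic_hom:
  assumes t: "t \<in> carrier G" "carrier G = range (\<lambda>n::int. t [^] n)"
    and "group H" and a: "a \<in> carrier H"
    and rel: "\<And>i::int. t [^] i = \<one> \<Longrightarrow> a [^]\<^bsub>H\<^esub> i = \<one>\<^bsub>H\<^esub>"
  obtains h where "h \<in> hom G H" "\<And>i::int. h (t [^] i) = a [^]\<^bsub>H\<^esub> i"
proof -
  interpret H: group H by fact
  define h where "h x = a [^]\<^bsub>H\<^esub> (SOME i::int. t [^] i = x)" for x
  have h: "h (t [^] i) = a [^]\<^bsub>H\<^esub> i" for i :: int
  proof -
    define k where "k = (SOME k::int. t [^] k = t [^] i)"
    have "t [^] k = t [^] i" unfolding k_def by (rule someI[of _ i]) simp
    then have "t [^] (i - k) = \<one>"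
      using t(1) by (simp add: int_pow_eq int_pow_eq_id)
    then have "int (H.ord a) dvd i - k" using rel[of "i - k"] a by (simp add: H.int_pow_eq_id)
    then have "a [^]\<^bsub>H\<^esub> k = a [^]\<^bsub>H\<^esub> i" using a by (simp add: H.int_pow_eq)
    then show ?thesis by (simp add: h_def k_def)
  qed
  have "h \<in> hom G H"
  proof (rule homI)
    show "h x \<in> carrier H" for x using a by (simp add: h_def)
    show "h (x \<otimes> y) = h x \<otimes>\<^bsub>H\<^esub> h y" if xy: "x \<in> carrier G" "y \<in> carrier G" for x y
    proof -
      obtain i j :: int where "x = t [^] i" "y = t [^] j" using xy unfolding t(2) by blast
      then have "x \<otimes> y = t [^] (i + j)" "x = t [^] i" "y = t [^] j"
        using t(1) by (simp_all add: int_pow_mult)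
      then show ?thesis using a by (simp add: h H.int_pow_mult)
    qed
  qed
  then show thesis using that h by blast
qed

lemma odd_exponent_involution:
  assumes "y \<in> carrier G" "y \<otimes> y = \<one>" "y [^] (m::nat) = \<one>" "odd m"
  shows "y = \<one>"
proof -
  have "y [^] (2::nat) = \<one>" using assms by (simp add: numeral_2_eq_2)
  then have "ord y dvd 2" "ord y dvd m" using assms pow_eq_id by blast+
  then have "ord y dvd 1" using coprime_common_divisor[of 2 m "ord y"] assms(4) by simp
  then show ?thesis using assms(1) ord_eq_1 by simp
qed

lemma commutator_eq_one_iff:
  assumes "x \<in> carrier G" "y \<in> carrier G"
  shows "commutator G x y = \<one> \<longleftrightarrow> x \<otimes> y = y \<otimes> x"
proof -
  have "commutator G x y = x \<otimes> y \<otimes> inv (y \<otimes> x)"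
    using assms by (simp add: commutator_def inv_mult_group m_assoc)
  then show ?thesis
    using assms by (simp add: inv_solve_right')
qed

end

section \<open>Homomorphisms out of a graph product\<close>

text \<open>
  A word is sent to the product of the images of its letters; both defining steps of the
  congruence preserve this product.
\<close>

lemma free_product_universal:
  assumes G: "\<And>u. u \<in> I \<Longrightarrow> group (G u)" and "group T"
    and hom: "\<And>u. u \<in> I \<Longrightarrow> \<phi> u \<in> hom (G u) T"
  obtains \<Phi> where "\<Phi> \<in> hom (free_product I G) T"
    "\<And>u g. u \<in> I \<Longrightarrow> g \<in> carrier (G u) \<Longrightarrow> \<Phi> (fp_incl I G u g) = \<phi> u g"
proof -
  interpret T: group T by fact
  define ev where "ev = (\<lambda>w. foldr (\<lambda>(u, g) t. \<phi> u g \<otimes>\<^bsub>T\<^esub> t) w \<one>\<^bsub>T\<^esub>)"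
  have ev_Nil: "ev [] = \<one>\<^bsub>T\<^esub>" and ev_Cons: "ev ((u, g) # w) = \<phi> u g \<otimes>\<^bsub>T\<^esub> ev w" for u g w
    by (simp_all add: ev_def)
  have \<phi>_closed: "\<phi> u g \<in> carrier T" if "u \<in> I" "g \<in> carrier (G u)" for u g
    using hom[OF that(1)] that(2) by (auto simp: hom_def)
  have ev_closed: "ev w \<in> carrier T" if "w \<in> fp_words I G" for w
    using that by (induction w) (auto simp: ev_Nil ev_Cons \<phi>_closed)
  have ev_append: "ev (w @ w') = ev w \<otimes>\<^bsub>T\<^esub> ev w'" if "w \<in> fp_words I G" "w' \<in> fp_words I G" for w w'
    using that by (induction w) (auto simp: ev_Nil ev_Cons \<phi>_closed ev_closed T.m_assoc)
  have ev_rel: "ev w = ev w'" if "(w, w') \<in> fp_rel I G" for w w'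
    using that
  proof induction
    case (unit xs ys u)
    have "\<phi> u \<one>\<^bsub>G u\<^esub> = \<one>\<^bsub>T\<^esub>" "\<one>\<^bsub>G u\<^esub> \<in> carrier (G u)"
      using hom_one[OF hom G \<open>group T\<close>] unit(3) G[THEN group.is_monoid, THEN monoid.one_closed] by auto
    with unit show ?case by (simp add: ev_append ev_Nil ev_Cons ev_closed)
  next
    case (mult xs ys u g h)
    have "\<phi> u (g \<otimes>\<^bsub>G u\<^esub> h) = \<phi> u g \<otimes>\<^bsub>T\<^esub> \<phi> u h" "g \<otimes>\<^bsub>G u\<^esub> h \<in> carrier (G u)"
      using hom_mult[OF hom] mult G[THEN group.is_monoid, THEN monoid.m_closed] by auto
    with mult show ?case
      by (simp add: ev_append ev_Cons ev_closed \<phi>_closed T.m_assoc)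
  qed simp_all
  define \<Phi> where "\<Phi> = (\<lambda>X. the_elem (ev ` X))"
  have \<Phi>: "\<Phi> (fp_rel I G `` {w}) = ev w" if "w \<in> fp_words I G" for w
  proof -
    have "ev ` (fp_rel I G `` {w}) = {ev w}"
    proof (intro equalityI subsetI)
      show "t \<in> {ev w}" if "t \<in> ev ` (fp_rel I G `` {w})" for t
        using that by (auto dest: ev_rel)
    qed (use fp_rel.refl[OF that] in blast)
    then show ?thesis by (simp add: \<Phi>_def)
  qed
  show thesis
  proof (rule that)
    show "\<Phi> \<in> hom (free_product I G) T"
    proof (rule homI)
      fix X assume "X \<in> carrier (free_product I G)"
      then show "\<Phi> X \<in> carrier T"
        by (auto simp: free_product_def \<Phi> ev_closed elim!: quotientE)
    next
      fix X Y assume "X \<in> carrier (free_product I G)" "Y \<in> carrier (free_product I G)"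
      then obtain x y where "x \<in> fp_words I G" "X = fp_rel I G `` {x}"
          "y \<in> fp_words I G" "Y = fp_rel I G `` {y}"
        by (auto simp: free_product_def elim!: quotientE)
      then show "\<Phi> (X \<otimes>\<^bsub>free_product I G\<^esub> Y) = \<Phi> X \<otimes>\<^bsub>T\<^esub> \<Phi> Y"
        using mult_free_product[of I G x y] G by (simp add: \<Phi> ev_append)
    qed
    show "\<Phi> (fp_incl I G u g) = \<phi> u g" if "u \<in> I" "g \<in> carrier (G u)" for u g
      using that by (simp add: fp_incl_def \<Phi> ev_Nil ev_Cons \<phi>_closed)
  qed
qed

locale graph_of_groups =
  fixes \<Gamma> :: "'v pair_pre_digraph" and G :: "'v \<Rightarrow> ('a, 'b) monoid_scheme"
  assumes graph: "pair_graph \<Gamma>"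
    and groups: "\<And>v. v \<in> pverts \<Gamma> \<Longrightarrow> group (G v)"
begin

abbreviation V where "V \<equiv> pverts \<Gamma>"
abbreviation F where "F \<equiv> free_product V G"
abbreviation P where "P \<equiv> graph_product \<Gamma> G"

lemma finite_V: "finite V"
  using graph by (simp add: pair_graph_def pair_digraph_def pair_fin_digraph_def pair_fin_digraph_axioms_def)

lemma arcs_sym: "(u, v) \<in> parcs \<Gamma> \<Longrightarrow> (v, u) \<in> parcs \<Gamma>"
  using graph unfolding pair_graph_def pair_pseudo_graph_def pair_sym_digraph_def pair_sym_digraph_axioms_def
  by (auto simp: symmetric_def sym_def)

lemma arcs_V: "(u, v) \<in> parcs \<Gamma> \<Longrightarrow> u \<in> V \<and> v \<in> V"
  using graph unfolding pair_graph_def pair_digraph_def pair_fin_digraph_def pair_wf_digraph_def by force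

lemma arcs_irrefl: "(u, u) \<notin> parcs \<Gamma>"
  using graph unfolding pair_graph_def pair_digraph_def pair_loopfree_digraph_def
    pair_loopfree_digraph_axioms_def by force

sublocale P: group P
  by (rule group_graph_product[OF graph groups])

lemma group_F: "group F"
  by (rule group_free_product[OF groups])

definition rels where "rels = normal_closure F (gp_relators \<Gamma> G)"

lemma fp_incl_closed:
  "u \<in> V \<Longrightarrow> g \<in> carrier (G u) \<Longrightarrow> fp_incl V G u g \<in> carrier F"
  by (auto simp: free_product_def fp_incl_def intro!: quotientI)

lemma fp_incl_mult:
  assumes u: "u \<in> V" and g: "g \<in> carrier (G u)" and h: "h \<in> carrier (G u)"
  shows "fp_incl V G u (g \<otimes>\<^bsub>G u\<^esub> h) = fp_incl V G u g \<otimes>\<^bsub>F\<^esub> fp_incl V G u h"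
proof -
  have "([(u, g), (u, h)], [(u, g \<otimes>\<^bsub>G u\<^esub> h)]) \<in> fp_rel V G"
    using fp_rel.mult[of "[]" V G "[]" u g h] assms by simp
  then have "fp_rel V G `` {[(u, g), (u, h)]} = fp_rel V G `` {[(u, g \<otimes>\<^bsub>G u\<^esub> h)]}"
    using equiv_class_eq[OF equiv_fp_rel[of V G, OF groups]] by blast
  then show ?thesis
    using assms by (simp add: fp_incl_def mult_free_product groups)
qed

lemma relators_closed: "gp_relators \<Gamma> G \<subseteq> carrier F"
proof -
  interpret F: group F by (rule group_F)
  show ?thesis
    by (auto simp: gp_relators_def commutator_def intro!: fp_incl_closed dest: arcs_V)
qed

lemma normal_rels: "rels \<lhd> F"
  unfolding rels_def by (rule group.normal_normal_closure[OF group_F relators_closed])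

lemma P_Mod: "P = F Mod rels"
  by (simp add: graph_product_def rels_def)

definition incl where "incl u g = rels #>\<^bsub>F\<^esub> fp_incl V G u g"

lemma quotient_map_hom: "(\<lambda>x. rels #>\<^bsub>F\<^esub> x) \<in> hom F P"
  using normal.r_coset_hom_Mod[OF normal_rels] by (simp add: P_Mod)

lemma incl_hom: "u \<in> V \<Longrightarrow> incl u \<in> hom (G u) P"
  using quotient_map_hom fp_incl_mult fp_incl_closed
  by (auto simp: hom_def incl_def Pi_iff)

lemma incl_closed [simp]: "u \<in> V \<Longrightarrow> g \<in> carrier (G u) \<Longrightarrow> incl u g \<in> carrier P"
  using incl_hom by (auto simp: hom_def)

lemma incl_mult: "u \<in> V \<Longrightarrow> g \<in> carrier (G u) \<Longrightarrow> h \<in> carrier (G u) \<Longrightarrow>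
    incl u (g \<otimes>\<^bsub>G u\<^esub> h) = incl u g \<otimes>\<^bsub>P\<^esub> incl u h"
  using incl_hom by (auto simp: hom_def)

lemma incl_one [simp]: "u \<in> V \<Longrightarrow> incl u \<one>\<^bsub>G u\<^esub> = \<one>\<^bsub>P\<^esub>"
  by (rule hom_one[OF incl_hom groups P.is_group])

lemma incl_inv: "u \<in> V \<Longrightarrow> g \<in> carrier (G u) \<Longrightarrow> incl u (inv\<^bsub>G u\<^esub> g) = inv\<^bsub>P\<^esub> (incl u g)"
  using group_hom.hom_inv[of "G u" P "incl u" g] incl_hom groups
  by (simp add: group_hom_def group_hom_axioms_def P.is_group)

lemma incl_commute:
  assumes "(u, v) \<in> parcs \<Gamma>" and g: "g \<in> carrier (G u)" and h: "h \<in> carrier (G v)"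
  shows "incl u g \<otimes>\<^bsub>P\<^esub> incl v h = incl v h \<otimes>\<^bsub>P\<^esub> incl u g"
proof -
  interpret F: group F by (rule group_F)
  interpret q: group_hom F P "\<lambda>x. rels #>\<^bsub>F\<^esub> x"
    using quotient_map_hom by (simp add: group_hom_def group_hom_axioms_def group_F P.is_group)
  have uv: "u \<in> V" "v \<in> V" using arcs_V[OF assms(1)] by auto
  have c: "fp_incl V G u g \<in> carrier F" "fp_incl V G v h \<in> carrier F"
    using uv g h by (auto intro: fp_incl_closed)
  have "commutator F (fp_incl V G u g) (fp_incl V G v h) \<in> rels"
    unfolding rels_def normal_closure_def
    by (rule hull_inc) (use assms in \<open>auto simp: gp_relators_def\<close>)
  moreover from this have "commutator F (fp_incl V G u g) (fp_incl V G v h) \<in> carrier F"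
    using subgroup.subset[OF normal_imp_subgroup[OF normal_rels]] by blast
  ultimately have "rels #>\<^bsub>F\<^esub> commutator F (fp_incl V G u g) (fp_incl V G v h) = \<one>\<^bsub>P\<^esub>"
    using F.coset_join2[OF _ normal_imp_subgroup[OF normal_rels]] unfolding P_Mod one_FactGroup
    by blast
  then have "commutator P (incl u g) (incl v h) = \<one>\<^bsub>P\<^esub>"
    using c by (simp add: commutator_def incl_def)
  then show ?thesis
    using uv g h by (simp add: P.commutator_eq_one_iff)
qed

theorem graph_product_universal:
  assumes "group T"
    and hom: "\<And>u. u \<in> V \<Longrightarrow> \<phi> u \<in> hom (G u) T"
    and comm: "\<And>u v g h. (u, v) \<in> parcs \<Gamma> \<Longrightarrow> g \<in> carrier (G u) \<Longrightarrow> h \<in> carrier (G v) \<Longrightarrow>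
      \<phi> u g \<otimes>\<^bsub>T\<^esub> \<phi> v h = \<phi> v h \<otimes>\<^bsub>T\<^esub> \<phi> u g"
  obtains \<Phi> where "\<Phi> \<in> hom P T"
    "\<And>u g. u \<in> V \<Longrightarrow> g \<in> carrier (G u) \<Longrightarrow> \<Phi> (incl u g) = \<phi> u g"
proof -
  interpret T: group T by fact
  obtain \<Psi> where \<Psi>: "\<Psi> \<in> hom F T"
    and \<Psi>_incl: "\<And>u g. u \<in> V \<Longrightarrow> g \<in> carrier (G u) \<Longrightarrow> \<Psi> (fp_incl V G u g) = \<phi> u g"
    by (rule free_product_universal[of V G T \<phi>, OF groups \<open>group T\<close> hom that])
  interpret \<Psi>: group_hom F T \<Psi>
    using \<Psi> by (simp add: group_hom_def group_hom_axioms_def group_F T.is_group)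
  have "gp_relators \<Gamma> G \<subseteq> kernel F T \<Psi>"
  proof
    fix x assume "x \<in> gp_relators \<Gamma> G"
    then obtain u v g h where x: "x = commutator F (fp_incl V G u g) (fp_incl V G v h)"
      and uv: "(u, v) \<in> parcs \<Gamma>" and g: "g \<in> carrier (G u)" and h: "h \<in> carrier (G v)"
      by (auto simp: gp_relators_def)
    have V: "u \<in> V" "v \<in> V" using arcs_V[OF uv] by auto
    have c: "fp_incl V G u g \<in> carrier F" "fp_incl V G v h \<in> carrier F"
      using V g h by (auto intro: fp_incl_closed)
    have c': "\<phi> u g \<in> carrier T" "\<phi> v h \<in> carrier T"
      using hom[OF V(1)] hom[OF V(2)] g h by (auto simp: hom_def)
    have "commutator T (\<phi> u g) (\<phi> v h) = \<one>\<^bsub>T\<^esub>"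
      using comm[OF uv g h] c' by (simp add: T.commutator_eq_one_iff)
    then show "x \<in> kernel F T \<Psi>"
      using c V g h by (simp add: x kernel_def commutator_def \<Psi>_incl)
  qed
  then have "rels \<subseteq> kernel F T \<Psi>"
    unfolding rels_def normal_closure_def by (intro hull_minimal \<Psi>.normal_kernel)
  have eq: "\<Psi> x = \<Psi> y"
    if "x \<in> carrier F" "y \<in> carrier F" "rels #>\<^bsub>F\<^esub> x = rels #>\<^bsub>F\<^esub> y" for x y
  proof -
    have "x \<in> rels #>\<^bsub>F\<^esub> y"
      using that \<Psi>.G.rcos_self normal_imp_subgroup[OF normal_rels] by metis
    then obtain r where "r \<in> rels" "x = r \<otimes>\<^bsub>F\<^esub> y" by (auto simp: r_coset_def)
    then show ?thesis
      using \<open>rels \<subseteq> kernel F T \<Psi>\<close> that by (auto simp: kernel_def)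
  qed
  obtain \<Phi> where \<Phi>: "\<Phi> \<in> hom (F Mod rels) T" "\<And>x. x \<in> carrier F \<Longrightarrow> \<Phi> (rels #>\<^bsub>F\<^esub> x) = \<Psi> x"
    by (rule FactGroup_universal[OF \<Psi> normal_rels eq that])
  show thesis
  proof
    show "\<Phi> \<in> hom P T" using \<Phi>(1) by (simp add: P_Mod)
    show "\<Phi> (incl u g) = \<phi> u g" if "u \<in> V" "g \<in> carrier (G u)" for u g
      using that by (simp add: incl_def \<Phi>(2) fp_incl_closed \<Psi>_incl)
  qed
qed

text \<open>
  Every element is a product of generators, so properties can be propagated by left multiplication
  with generators. The action below is defined on the left, which is why this side is chosen.
\<close>

lemma generator_induct [consumes 1, case_names one incl]:
  assumes x: "x \<in> carrier P"
    and one: "Q \<one>\<^bsub>P\<^esub>"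
    and step: "\<And>u g y. u \<in> V \<Longrightarrow> g \<in> carrier (G u) \<Longrightarrow> y \<in> carrier P \<Longrightarrow> Q y \<Longrightarrow> Q (incl u g \<otimes>\<^bsub>P\<^esub> y)"
  shows "Q x"
proof -
  let ?c = "\<lambda>w. rels #>\<^bsub>F\<^esub> (fp_rel V G `` {w})"
  have *: "?c w \<in> carrier P \<and> Q (?c w)" if "w \<in> fp_words V G" for w
    using that
  proof (induction w)
    case Nil
    have "fp_rel V G `` {[]} = \<one>\<^bsub>F\<^esub>" by (simp add: free_product_def)
    then show ?case
      using one hom_one[OF quotient_map_hom group_F P.is_group] by simp
  next
    case (Cons l w)
    obtain u g where l: "l = (u, g)" by fastforce
    with Cons have u: "u \<in> V" and g: "g \<in> carrier (G u)" and w: "w \<in> fp_words V G" by auto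
    have wc: "fp_rel V G `` {w} \<in> carrier F"
      using w by (auto simp: free_product_def intro: quotientI)
    have "fp_rel V G `` {l # w} = fp_incl V G u g \<otimes>\<^bsub>F\<^esub> fp_rel V G `` {w}"
      using u g w by (simp add: fp_incl_def mult_free_product groups l)
    then have "?c (l # w) = incl u g \<otimes>\<^bsub>P\<^esub> ?c w"
      using hom_mult[OF quotient_map_hom fp_incl_closed[OF u g] wc] by (simp add: incl_def)
    then show ?case using Cons.IH[OF w] step u g by simp
  qed
  obtain y where y: "y \<in> carrier F" "x = rels #>\<^bsub>F\<^esub> y"
    using x by (auto simp: P_Mod carrier_FactGroup)
  then obtain w where "w \<in> fp_words V G" "y = fp_rel V G `` {w}"
    by (auto simp: free_product_def elim!: quotientE)
  then show ?thesis using * y(2) by simp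
qed

lemma hom_eqI:
  assumes "group T" "\<Phi> \<in> hom P T" "\<Psi> \<in> hom P T"
    and eq: "\<And>u g. u \<in> V \<Longrightarrow> g \<in> carrier (G u) \<Longrightarrow> \<Phi> (incl u g) = \<Psi> (incl u g)"
    and x: "x \<in> carrier P"
  shows "\<Phi> x = \<Psi> x"
  using x
proof (induction rule: generator_induct)
  case one
  show ?case
    using hom_one[OF assms(2) P.is_group assms(1)] hom_one[OF assms(3) P.is_group assms(1)] by simp
next
  case (incl u g y)
  then show ?case
    using hom_mult[OF assms(2), of "incl u g" y] hom_mult[OF assms(3), of "incl u g" y] eq[of u g] by simp
qed

section \<open>Retractions onto subsets of the vertices\<close>

text \<open>
  The homomorphism that extends the maps given on the vertex groups; unspecified if these maps do
  not extend.
\<close>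

definition lift :: "('t, 's) monoid_scheme \<Rightarrow> ('v \<Rightarrow> 'a \<Rightarrow> 't) \<Rightarrow> ('v \<times> 'a) list set set \<Rightarrow> 't" where
  "lift T \<phi> = (SOME \<Phi>. \<Phi> \<in> hom P T \<and> (\<forall>u\<in>V. \<forall>g\<in>carrier (G u). \<Phi> (incl u g) = \<phi> u g))"

lemma
  assumes "group T"
    and hom: "\<And>u. u \<in> V \<Longrightarrow> \<phi> u \<in> hom (G u) T"
    and comm: "\<And>u v g h. (u, v) \<in> parcs \<Gamma> \<Longrightarrow> g \<in> carrier (G u) \<Longrightarrow> h \<in> carrier (G v) \<Longrightarrow>
      \<phi> u g \<otimes>\<^bsub>T\<^esub> \<phi> v h = \<phi> v h \<otimes>\<^bsub>T\<^esub> \<phi> u g"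
  shows lift_hom: "lift T \<phi> \<in> hom P T"
    and lift_incl: "\<And>u g. u \<in> V \<Longrightarrow> g \<in> carrier (G u) \<Longrightarrow> lift T \<phi> (incl u g) = \<phi> u g"
proof -
  have "\<exists>\<Phi>. \<Phi> \<in> hom P T \<and> (\<forall>u\<in>V. \<forall>g\<in>carrier (G u). \<Phi> (incl u g) = \<phi> u g)"
    by (rule graph_product_universal[OF \<open>group T\<close> hom comm]) auto
  from someI_ex[OF this] show "lift T \<phi> \<in> hom P T"
    and "\<And>u g. u \<in> V \<Longrightarrow> g \<in> carrier (G u) \<Longrightarrow> lift T \<phi> (incl u g) = \<phi> u g"
    by (auto simp: lift_def)
qed

lemma trivial_hom_P: "u \<in> V \<Longrightarrow> (\<lambda>g. \<one>\<^bsub>P\<^esub>) \<in> hom (G u) P"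
  by (simp add: hom_def)

text \<open>
  The retraction onto the subgroup P_U generated by the vertex groups in U, as an endomorphism of
  P itself. So P_U is the set of fixed points of proj U, and retractions for different U can be
  composed.
\<close>

definition proj where "proj U = lift P (\<lambda>u g. if u \<in> U then incl u g else \<one>\<^bsub>P\<^esub>)"

lemma proj_hom: "proj U \<in> hom P P"
  and proj_incl [simp]: "u \<in> V \<Longrightarrow> g \<in> carrier (G u) \<Longrightarrow>
        proj U (incl u g) = (if u \<in> U then incl u g else \<one>\<^bsub>P\<^esub>)"
proof -
  let ?\<phi> = "\<lambda>u g. if u \<in> U then incl u g else \<one>\<^bsub>P\<^esub>"
  have hom: "?\<phi> u \<in> hom (G u) P" if "u \<in> V" for u
    using incl_hom[OF that] trivial_hom_P[OF that] by (cases "u \<in> U") auto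
  have comm: "?\<phi> u g \<otimes>\<^bsub>P\<^esub> ?\<phi> w h = ?\<phi> w h \<otimes>\<^bsub>P\<^esub> ?\<phi> u g"
    if "(u, w) \<in> parcs \<Gamma>" "g \<in> carrier (G u)" "h \<in> carrier (G w)" for u w g h
    using that arcs_V[OF that(1)] incl_commute[OF that] by simp
  show "proj U \<in> hom P P"
    unfolding proj_def by (rule lift_hom[OF P.is_group hom comm])
  show "u \<in> V \<Longrightarrow> g \<in> carrier (G u) \<Longrightarrow> proj U (incl u g) = ?\<phi> u g" for u g
    unfolding proj_def by (rule lift_incl[OF P.is_group hom comm])
qed

sublocale proj: group_hom P P "proj U" for U
  by unfold_locales (rule proj_hom)

lemma proj_proj:
  assumes x: "x \<in> carrier P"
  shows "proj U (proj W x) = proj (U \<inter> W) x"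
proof -
  have "(proj U \<circ> proj W) x = proj (U \<inter> W) x"
    by (rule hom_eqI[OF P.is_group hom_compose[OF proj_hom proj_hom] proj_hom _ x]) simp
  then show ?thesis by simp
qed

lemma proj_superset: "x \<in> carrier P \<Longrightarrow> V \<subseteq> U \<Longrightarrow> proj U x = x"
  by (rule hom_eqI[OF P.is_group proj_hom, of "\<lambda>x. x"]) (auto simp: hom_def)

lemma proj_disjoint: "x \<in> carrier P \<Longrightarrow> V \<inter> U = {} \<Longrightarrow> proj U x = \<one>\<^bsub>P\<^esub>"
  by (rule hom_eqI[OF P.is_group proj_hom, of "\<lambda>x. \<one>\<^bsub>P\<^esub>"]) (auto simp: hom_def)

text \<open>
  The retractions commute, and their composition is the retraction onto the intersection.
  Therefore the intersection of the subgroups P_(V - v) with v outside U is P_U.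
\<close>

lemma proj_fixed_Int:
  assumes "x \<in> carrier P" "U \<subseteq> V" and fixed: "\<And>v. v \<in> V - U \<Longrightarrow> proj (V - {v}) x = x"
  shows "proj U x = x"
proof -
  have "proj (V - A) x = x" if "finite A" "A \<subseteq> V - U" for A
    using that
  proof (induction A)
    case empty
    then show ?case using assms(1) by (simp add: proj_superset)
  next
    case (insert v A)
    have "V - insert v A = (V - A) \<inter> (V - {v})" by auto
    then show ?case
      using insert fixed[of v] proj_proj[OF assms(1), of "V - A" "V - {v}"] by simp
  qed
  from this[of "V - U"] show ?thesis
    using finite_V assms(2) by (simp add: double_diff)
qed

definition coord where "coord v = lift (G v) (\<lambda>u g. if u = v then g else \<one>\<^bsub>G v\<^esub>)"

lemma coord_hom: "v \<in> V \<Longrightarrow> coord v \<in> hom P (G v)"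
  and coord_incl: "v \<in> V \<Longrightarrow> u \<in> V \<Longrightarrow> g \<in> carrier (G u) \<Longrightarrow>
        coord v (incl u g) = (if u = v then g else \<one>\<^bsub>G v\<^esub>)"
proof -
  let ?\<phi> = "\<lambda>u g. if u = v then g else \<one>\<^bsub>G v\<^esub>"
  assume v: "v \<in> V"
  interpret Gv: group "G v" by (rule groups[OF v])
  have hom: "?\<phi> u \<in> hom (G u) (G v)" if "u \<in> V" for u
    by (cases "u = v") (auto simp: hom_def)
  have comm: "?\<phi> u g \<otimes>\<^bsub>G v\<^esub> ?\<phi> w h = ?\<phi> w h \<otimes>\<^bsub>G v\<^esub> ?\<phi> u g"
    if "(u, w) \<in> parcs \<Gamma>" "g \<in> carrier (G u)" "h \<in> carrier (G w)" for u w g h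
    using that arcs_irrefl by auto
  show "coord v \<in> hom P (G v)"
    unfolding coord_def by (rule lift_hom[OF Gv.is_group hom comm])
  show "u \<in> V \<Longrightarrow> g \<in> carrier (G u) \<Longrightarrow> coord v (incl u g) = ?\<phi> u g" for u g
    unfolding coord_def by (rule lift_incl[OF Gv.is_group hom comm])
qed

lemma incl_eq_iff: "v \<in> V \<Longrightarrow> g \<in> carrier (G v) \<Longrightarrow> h \<in> carrier (G v) \<Longrightarrow> incl v g = incl v h \<longleftrightarrow> g = h"
  using coord_incl[of v v] by metis

lemma incl_coord:
  assumes "v \<in> V" "x \<in> carrier P"
  shows "incl v (coord v x) = proj {v} x"
proof -
  have "(incl v \<circ> coord v) x = proj {v} x"
    by (rule hom_eqI[OF P.is_group hom_compose[OF coord_hom incl_hom] proj_hom _ assms(2)])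
      (use assms in \<open>simp_all add: coord_incl\<close>)
  then show ?thesis by simp
qed

lemma commuteI:
  assumes y: "y \<in> carrier P" and x: "x \<in> carrier P" and "U \<subseteq> V"
    and comm: "\<And>u g. u \<in> U \<Longrightarrow> g \<in> carrier (G u) \<Longrightarrow> y \<otimes>\<^bsub>P\<^esub> incl u g = incl u g \<otimes>\<^bsub>P\<^esub> y"
  shows "y \<otimes>\<^bsub>P\<^esub> proj U x = proj U x \<otimes>\<^bsub>P\<^esub> y"
  using x
proof (induction rule: generator_induct)
  case (incl u g x)
  show ?case
  proof (cases "u \<in> U")
    case True
    have "y \<otimes>\<^bsub>P\<^esub> (incl u g \<otimes>\<^bsub>P\<^esub> proj U x) = incl u g \<otimes>\<^bsub>P\<^esub> y \<otimes>\<^bsub>P\<^esub> proj U x"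
      using incl y comm[OF True incl(2)] by (simp flip: P.m_assoc)
    also have "\<dots> = incl u g \<otimes>\<^bsub>P\<^esub> proj U x \<otimes>\<^bsub>P\<^esub> y"
      using incl y by (simp add: P.m_assoc)
    finally show ?thesis using incl True by simp
  qed (use incl in simp)
qed (use y in simp)

end

section \<open>Reduced words of a free product of copies of one group\<close>

text \<open>
  Left multiplication of a reduced word by the letter (c, p) in the free product of copies of the
  group M, where c names the copy. The letter is merged into the first letter of the word if that
  lies in the same copy, and identity letters are dropped.
\<close>

definition push ::
    "('a, 'b) monoid_scheme \<Rightarrow> 'c \<Rightarrow> 'a \<Rightarrow> ('c \<times> 'a) list \<Rightarrow> ('c \<times> 'a) list" where
  "push M c p w =
     (if p = \<one>\<^bsub>M\<^esub> then w
      else case w of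
        [] \<Rightarrow> [(c, p)]
      | (d, q) # w' \<Rightarrow>
          if d \<noteq> c then (c, p) # w
          else if p \<otimes>\<^bsub>M\<^esub> q = \<one>\<^bsub>M\<^esub> then w' else (c, p \<otimes>\<^bsub>M\<^esub> q) # w')"

definition push_word ::
    "('a, 'b) monoid_scheme \<Rightarrow> ('c \<times> 'a) list \<Rightarrow> ('c \<times> 'a) list \<Rightarrow> ('c \<times> 'a) list" where
  "push_word M w z = foldr (\<lambda>(c, p). push M c p) w z"

text \<open>
  The normal forms of a free product of copies of M indexed by C: no identity letters, and
  neighbouring letters from different copies.
\<close>

definition reduced_words ::
    "('a, 'b) monoid_scheme \<Rightarrow> 'c set \<Rightarrow> ('c \<times> 'a) list set" where
  "reduced_words M C = {w. set w \<subseteq> C \<times> (carrier M - {\<one>\<^bsub>M\<^esub>}) \<and> distinct_adj (map fst w)}"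

lemma push_word_simps [simp]:
  "push_word M [] z = z"
  "push_word M ((c, p) # w) z = push M c p (push_word M w z)"
  "push_word M (w @ w') z = push_word M w (push_word M w' z)"
  by (simp_all add: push_word_def)

lemma Nil_reduced [simp]: "[] \<in> reduced_words M C"
  by (simp add: reduced_words_def)

lemma Cons_reduced:
  "(c, p) # w \<in> reduced_words M C \<longleftrightarrow>
     c \<in> C \<and> p \<in> carrier M \<and> p \<noteq> \<one>\<^bsub>M\<^esub> \<and> (w = [] \<or> c \<noteq> fst (hd w)) \<and> w \<in> reduced_words M C"
  by (cases w) (auto simp: reduced_words_def)

lemma append_reduced:
  "w @ z \<in> reduced_words M C \<longleftrightarrow>
     w \<in> reduced_words M C \<and> z \<in> reduced_words M C \<and> (w = [] \<or> z = [] \<or> fst (last w) \<noteq> fst (hd z))"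
  by (auto simp: reduced_words_def distinct_adj_append_iff hd_map last_map)

lemma map_reduced:
  assumes "inj_on f C" "f ` C \<subseteq> C" "w \<in> reduced_words M C"
  shows "map (apfst f) w \<in> reduced_words M C"
proof -
  have C: "fst ` set w \<subseteq> C" using assms(3) by (auto simp: reduced_words_def)
  have "distinct_adj (map f (map fst w))"
    by (rule distinct_adj_mapI)
      (use assms C in \<open>auto simp: reduced_words_def intro: inj_on_subset[of f C]\<close>)
  then show ?thesis using assms(2,3) 
    by (auto 0 3 simp: reduced_words_def comp_def image_subset_iff dest: subsetD)
qed

lemma map_push:
  assumes "inj_on f C" "c \<in> C" "w \<in> reduced_words M C"
  shows "map (apfst f) (push M c p w) = push M (f c) p (map (apfst f) w)"
proof (cases w)
  case (Cons l w')
  obtain d q where l: "l = (d, q)" by fastforce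
  have "d \<in> C" using assms(3) unfolding Cons l Cons_reduced by simp
  then have "f d = f c \<longleftrightarrow> d = c" using assms(1,2) by (auto dest: inj_onD)
  then show ?thesis unfolding Cons l by (simp add: push_def)
qed (simp add: push_def)

lemma length_push_le: "length (push M c p w) \<le> Suc (length w)"
  by (auto simp: push_def split: list.split)

lemma length_push_word_le: "length (push_word M w z) \<le> length w + length z"
proof (induction w)
  case (Cons l w)
  then show ?case
    using length_push_le[of M "fst l" "snd l" "push_word M w z"] by (cases l) simp
qed simp

text \<open>
  The last letter of the word absorbs the new letter, or cancels with it.
\<close>

lemma push_word_merge_length:
  assumes "w \<noteq> []" and "fst (last w) = c"
  shows "length (push_word M w [(c, q)]) \<le> length w"
proof -
  obtain w' p where w: "w = w' @ [(c, p)]"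
    using assms by (metis append_butlast_last_id prod.collapse)
  have "length (push M c p [(c, q)]) \<le> 1" by (simp add: push_def)
  then show ?thesis
    using length_push_word_le[of M w' "push M c p [(c, q)]"] by (simp add: w)
qed

lemma push_word_append:
  assumes "w @ z \<in> reduced_words M C"
  shows "push_word M w z = w @ z"
  using assms
proof (induction w)
  case (Cons l w)
  obtain c p where l: "l = (c, p)" by fastforce
  have "push M c p (w @ z) = (c, p) # w @ z"
    using Cons.prems unfolding l append_Cons Cons_reduced
    by (auto simp: push_def split: list.split)
  then show ?case using Cons by (simp add: l Cons_reduced)
qed simp

context group
begin

lemma push_one [simp]: "push G c \<one> w = w"
  by (simp add: push_def)

lemma push_reduced:
  assumes "c \<in> C" "p \<in> carrier G" "w \<in> reduced_words G C"
  shows "push G c p w \<in> reduced_words G C"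
proof (cases w)
  case (Cons l w')
  obtain d q where l: "l = (d, q)" by fastforce
  show ?thesis using assms unfolding Cons l by (auto simp: push_def Cons_reduced)
qed (use assms in \<open>simp add: push_def Cons_reduced\<close>)

text \<open>
  This is van der Waerden's argument for the normal form of a free product: pushing letters of one
  copy is an action of the group M.
\<close>

lemma push_push:
  assumes p: "p \<in> carrier G" and q: "q \<in> carrier G" and w: "w \<in> reduced_words G C"
  shows "push G c p (push G c q w) = push G c (p \<otimes> q) w"
proof (cases w)
  case Nil
  then show ?thesis using p q by (simp add: push_def)
next
  case (Cons l w')
  obtain d r where l: "l = (d, r)" by fastforce
  have r: "r \<in> carrier G" and w': "w' = [] \<or> d \<noteq> fst (hd w')"
    using w unfolding Cons l Cons_reduced by auto
  show ?thesis
  proof (cases "d = c")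
    case False
    then show ?thesis using p q by (simp add: push_def Cons l)
  next
    case True
    \<comment> \<open>Since w is reduced, its tail starts in another copy, so letters of the copy
    c pushed onto the tail are only prefixed to it.\<close>
    have push': "push G c s w' = (if s = \<one> then w' else (c, s) # w')" for s
      using w' True by (auto simp: push_def split: list.split)
    have pushw: "push G c s w = push G c (s \<otimes> r) w'" if "s \<in> carrier G" for s
      using that r w Cons_reduced[of d r w'] by (auto simp: push' push_def[of G c s "(c, r) # w'"] Cons l True)
    have "push G c p (push G c s w') = push G c (p \<otimes> s) w'" if "s \<in> carrier G" for s
      using that p by (simp add: push' push_def[of G c p "(c, s) # w'"])
    from this[of "q \<otimes> r"] show ?thesis
      using p q r by (simp add: pushw m_assoc)
  qed
qed

lemma push_word_reduced:
  assumes "w \<in> reduced_words G C" "z \<in> reduced_words G C"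
  shows "push_word G w z \<in> reduced_words G C"
  using assms(1)
proof (induction w)
  case (Cons l w)
  then show ?case
    using push_reduced[of "fst l" C "snd l" "push_word G w z"] Cons_reduced[of "fst l" "snd l" w G C]
    by (cases l) simp
qed (use assms(2) in simp)

lemma map_push_word:
  assumes "inj_on f C" "w \<in> reduced_words G C" "z \<in> reduced_words G C"
  shows "map (apfst f) (push_word G w z) = push_word G (map (apfst f) w) (map (apfst f) z)"
  using assms(2)
proof (induction w)
  case (Cons l w)
  obtain d q where l: "l = (d, q)" by fastforce
  show ?case
    using Cons map_push[OF assms(1), of d "push_word G w z" G q] push_word_reduced[OF _ assms(3)]
    by (simp add: l Cons_reduced)
qed simp

text \<open>
  Associativity for the multiplication of reduced words, in the form that is needed to compare the
  word of a product with the words of its factors.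
\<close>

lemma push_word_push:
  assumes "c \<in> C" and p: "p \<in> carrier G" and w: "w \<in> reduced_words G C" and z: "z \<in> reduced_words G C"
  shows "push_word G (push G c p w) z = push G c p (push_word G w z)"
proof (cases w)
  case (Cons l w')
  obtain d r where l: "l = (d, r)" by fastforce
  have r: "r \<in> carrier G" and w': "w' \<in> reduced_words G C"
    using w unfolding Cons l Cons_reduced by auto
  have "push G c p (push G c r (push_word G w' z)) = push G c (p \<otimes> r) (push_word G w' z)"
    by (rule push_push[OF p r push_word_reduced[OF w' z]])
  then show ?thesis by (auto simp: push_def[of G c p "(d, r) # w'"] Cons l)
qed (simp add: push_def)

end

lemma hom_BijGroupI:
  assumes "group H"
    and closed: "\<And>g x. g \<in> carrier H \<Longrightarrow> x \<in> X \<Longrightarrow> f g x \<in> X"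
    and one: "\<And>x. x \<in> X \<Longrightarrow> f \<one>\<^bsub>H\<^esub> x = x"
    and mult: "\<And>g h x. g \<in> carrier H \<Longrightarrow> h \<in> carrier H \<Longrightarrow> x \<in> X \<Longrightarrow> f (g \<otimes>\<^bsub>H\<^esub> h) x = f g (f h x)"
  shows "(\<lambda>g. \<lambda>x\<in>X. f g x) \<in> hom H (BijGroup X)"
proof -
  interpret H: group H by fact
  have Bij: "(\<lambda>x\<in>X. f g x) \<in> Bij X" if g: "g \<in> carrier H" for g
  proof -
    have "f (inv\<^bsub>H\<^esub> g) (f g x) = x" "f g (f (inv\<^bsub>H\<^esub> g) x) = x" if "x \<in> X" for x
      using that g one mult[of "inv\<^bsub>H\<^esub> g" g x] mult[of g "inv\<^bsub>H\<^esub> g" x] by simp_all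
    then have "bij_betw (\<lambda>x\<in>X. f g x) X X"
      using g closed H.inv_closed by (intro bij_betw_byWitness[where f' = "f (inv\<^bsub>H\<^esub> g)"]) auto
    then show ?thesis by (simp add: Bij_def)
  qed
  show ?thesis
  proof (rule homI)
    show "(\<lambda>x\<in>X. f g x) \<in> carrier (BijGroup X)" if "g \<in> carrier H" for g
      using Bij that by (simp add: BijGroup_def)
    show "(\<lambda>x\<in>X. f (g \<otimes>\<^bsub>H\<^esub> h) x) = (\<lambda>x\<in>X. f g x) \<otimes>\<^bsub>BijGroup X\<^esub> (\<lambda>x\<in>X. f h x)"
      if "g \<in> carrier H" "h \<in> carrier H" for g h
    proof -
      have "(\<lambda>x\<in>X. f g x) \<otimes>\<^bsub>BijGroup X\<^esub> (\<lambda>x\<in>X. f h x) = compose X (\<lambda>x\<in>X. f g x) (\<lambda>x\<in>X. f h x)"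
        using Bij that by (simp add: BijGroup_def)
      also have "\<dots> = (\<lambda>x\<in>X. f (g \<otimes>\<^bsub>H\<^esub> h) x)"
        using that closed mult by (auto simp: compose_def fun_eq_iff)
      finally show ?thesis by simp
    qed
  qed
qed

section \<open>The action of a graph product on reduced words\<close>

context graph_of_groups
begin

text \<open>
  The subgroup L generated by the vertex groups of the link of v.
\<close>

definition link_subgroup where
  "link_subgroup v = {y \<in> carrier P. proj {u. (v, u) \<in> parcs \<Gamma>} y = y}"

text \<open>
  The index set of the copies of G_v. The coset of h stands for the conjugate of G_v by h, which
  depends on the coset only because L commutes with G_v. The cosets that occur in the words of
  elements of P are those that meet the image of proj (V - {v}).
\<close>

definition link_cosets where
  "link_cosets v = (\<lambda>h. h <#\<^bsub>P\<^esub> link_subgroup v) ` carrier P"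

definition translate where
  "translate h = map (apfst (\<lambda>c. h <#\<^bsub>P\<^esub> c))"

definition act_gen where
  "act_gen v u g = (if u = v then push (G v) (link_subgroup v) g else translate (incl u g))"

context
  fixes v assumes v: "v \<in> V"
begin

abbreviation L where "L \<equiv> link_subgroup v"
abbreviation C where "C \<equiv> link_cosets v"
abbreviation X where "X \<equiv> reduced_words (G v) C"
abbreviation \<rho> where "\<rho> \<equiv> proj (V - {v})"

interpretation Gv: group "G v" by (rule groups[OF v])

lemma L_subset: "L \<subseteq> carrier P"
  by (auto simp: link_subgroup_def)

lemma subgroup_L: "subgroup L P"
  by (rule P.subgroupI) (auto simp: link_subgroup_def intro: exI[of _ "\<one>\<^bsub>P\<^esub>"])

lemma coset_self: "h \<in> carrier P \<Longrightarrow> h \<in> h <#\<^bsub>P\<^esub> L"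
  using subgroup.one_closed[OF subgroup_L] by (force simp: l_coset_def)

lemma L_in_C: "L \<in> C"
  unfolding link_cosets_def by (rule image_eqI[of _ _ "\<one>\<^bsub>P\<^esub>"]) (simp_all add: L_subset P.lcos_mult_one)

lemma C_subset: "c \<in> C \<Longrightarrow> c \<subseteq> carrier P"
  using L_subset by (auto simp: link_cosets_def l_coset_def)

lemma coset_closed: "h \<in> carrier P \<Longrightarrow> c \<in> C \<Longrightarrow> h <#\<^bsub>P\<^esub> c \<in> C"
  by (auto simp: link_cosets_def P.lcos_m_assoc L_subset)

lemma coset_assoc: "h \<in> carrier P \<Longrightarrow> k \<in> carrier P \<Longrightarrow> c \<in> C \<Longrightarrow> h <#\<^bsub>P\<^esub> (k <#\<^bsub>P\<^esub> c) = (h \<otimes>\<^bsub>P\<^esub> k) <#\<^bsub>P\<^esub> c"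
  by (rule P.lcos_m_assoc[OF C_subset])

lemma coset_inj: "h \<in> carrier P \<Longrightarrow> inj_on (\<lambda>c. h <#\<^bsub>P\<^esub> c) C"
  by (rule inj_on_inverseI[where g = "\<lambda>c. inv\<^bsub>P\<^esub> h <#\<^bsub>P\<^esub> c"])
    (simp add: coset_assoc P.lcos_mult_one C_subset)

text \<open>
  Outside the vertex v, only the vertices of the link stabilise the coset L. For a vertex off the
  link, the retraction onto the link tells its elements from those of L.
\<close>

lemma incl_coset_L:
  assumes "u \<in> V" "u \<noteq> v" and g: "g \<in> carrier (G u)"
  shows "incl u g <#\<^bsub>P\<^esub> L = L \<longleftrightarrow> (v, u) \<in> parcs \<Gamma> \<or> g = \<one>\<^bsub>G u\<^esub>"
proof -
  have "incl u g <#\<^bsub>P\<^esub> L = L \<longleftrightarrow> incl u g \<in> L"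
    using coset_self[of "incl u g"] P.coset_join3[OF _ subgroup_L, of "incl u g"] assms
    by auto
  also have "\<dots> \<longleftrightarrow> (v, u) \<in> parcs \<Gamma> \<or> g = \<one>\<^bsub>G u\<^esub>"
    using assms incl_eq_iff[of u g "\<one>\<^bsub>G u\<^esub>"] groups[THEN group.is_monoid, THEN monoid.one_closed]
    by (auto simp: link_subgroup_def eq_commute[of "\<one>\<^bsub>P\<^esub>"])
  finally show ?thesis .
qed

lemma translate_closed: "h \<in> carrier P \<Longrightarrow> w \<in> X \<Longrightarrow> translate h w \<in> X"
  unfolding translate_def by (rule map_reduced) (auto simp: coset_inj coset_closed)

lemma letters_in_C: "w \<in> X \<Longrightarrow> (c, p) \<in> set w \<Longrightarrow> c \<in> C \<and> p \<in> carrier (G v)"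
  by (auto simp: reduced_words_def)

lemma translate_one: "w \<in> X \<Longrightarrow> translate \<one>\<^bsub>P\<^esub> w = w"
  unfolding translate_def by (rule map_idI) (auto simp: P.lcos_mult_one C_subset dest: letters_in_C)

lemma translate_mult:
  "h \<in> carrier P \<Longrightarrow> k \<in> carrier P \<Longrightarrow> w \<in> X \<Longrightarrow> translate (h \<otimes>\<^bsub>P\<^esub> k) w = translate h (translate k w)"
  unfolding translate_def by (auto simp: coset_assoc dest: letters_in_C)

lemma translate_push:
  "h \<in> carrier P \<Longrightarrow> c \<in> C \<Longrightarrow> w \<in> X \<Longrightarrow>
    translate h (push (G v) c p w) = push (G v) (h <#\<^bsub>P\<^esub> c) p (translate h w)"
  unfolding translate_def by (rule map_push[OF coset_inj])

lemma translate_push_word: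
  "h \<in> carrier P \<Longrightarrow> w \<in> X \<Longrightarrow> z \<in> X \<Longrightarrow>
    translate h (push_word (G v) w z) = push_word (G v) (translate h w) (translate h z)"
  unfolding translate_def by (rule Gv.map_push_word[OF coset_inj])

lemma act_gen_hom:
  assumes u: "u \<in> V"
  shows "(\<lambda>g. \<lambda>w\<in>X. act_gen v u g w) \<in> hom (G u) (BijGroup X)"
proof (rule hom_BijGroupI[OF groups[OF u]])
  interpret Gu: group "G u" by (rule groups[OF u])
  show "act_gen v u g w \<in> X" if "g \<in> carrier (G u)" "w \<in> X" for g w
    using u that by (auto simp: act_gen_def Gv.push_reduced L_in_C translate_closed)
  show "act_gen v u \<one>\<^bsub>G u\<^esub> w = w" if "w \<in> X" for w
    using u that by (auto simp: act_gen_def translate_one)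
  show "act_gen v u (g \<otimes>\<^bsub>G u\<^esub> h) w = act_gen v u g (act_gen v u h w)"
    if "g \<in> carrier (G u)" "h \<in> carrier (G u)" "w \<in> X" for g h w
    using u that Gv.push_push[of g h w C L]
    by (cases "u = v") (auto simp: act_gen_def incl_mult translate_mult)
qed

text \<open>
  The only relations of P that are not obvious are those between G_v and the groups of the link:
  they hold because the link fixes the copy at L, into which G_v pushes its letters.
\<close>

lemma act_gen_commute:
  assumes ab: "(a, b) \<in> parcs \<Gamma>" and g: "g \<in> carrier (G a)" and h: "h \<in> carrier (G b)" and w: "w \<in> X"
  shows "act_gen v a g (act_gen v b h w) = act_gen v b h (act_gen v a g w)"
proof -
  have V: "a \<in> V" "b \<in> V" "a \<noteq> b"
    using arcs_V[OF ab] ab arcs_irrefl by auto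
  have *: "push (G v) L p (translate (incl u k) w) = translate (incl u k) (push (G v) L p w)"
    if "(v, u) \<in> parcs \<Gamma>" "k \<in> carrier (G u)" for u k p
    using that arcs_V[OF that(1)] arcs_irrefl w incl_coset_L[of u k]
    by (cases "u = v") (auto simp: translate_push L_in_C)
  show ?thesis
  proof (cases "a = v \<or> b = v")
    case True
    then show ?thesis
      using *[of b h g] *[of a g h] ab arcs_sym[OF ab] V g h by (auto simp: act_gen_def)
  next
    case False
    then show ?thesis
      using V g h w incl_commute[OF ab g h] by (simp add: act_gen_def flip: translate_mult)
  qed
qed

definition act where
  "act = lift (BijGroup X) (\<lambda>u g. \<lambda>w\<in>X. act_gen v u g w)"

lemma act_hom: "act \<in> hom P (BijGroup X)"
  and act_incl: "\<And>u g w. u \<in> V \<Longrightarrow> g \<in> carrier (G u) \<Longrightarrow> w \<in> X \<Longrightarrow> act (incl u g) w = act_gen v u g w"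
proof -
  have comm: "(\<lambda>w\<in>X. act_gen v a g w) \<otimes>\<^bsub>BijGroup X\<^esub> (\<lambda>w\<in>X. act_gen v b h w)
      = (\<lambda>w\<in>X. act_gen v b h w) \<otimes>\<^bsub>BijGroup X\<^esub> (\<lambda>w\<in>X. act_gen v a g w)"
    if ab: "(a, b) \<in> parcs \<Gamma>" and gh: "g \<in> carrier (G a)" "h \<in> carrier (G b)" for a b g h
  proof -
    have V: "a \<in> V" "b \<in> V" using arcs_V[OF ab] by auto
    have B: "(\<lambda>w\<in>X. act_gen v a g w) \<in> Bij X" "(\<lambda>w\<in>X. act_gen v b h w) \<in> Bij X"
      using hom_in_carrier[OF act_gen_hom[OF V(1)] gh(1)] hom_in_carrier[OF act_gen_hom[OF V(2)] gh(2)]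
      by (simp_all add: BijGroup_def)
    then have "act_gen v a g w \<in> X" "act_gen v b h w \<in> X" if "w \<in> X" for w
      using that B[THEN Bij_imp_funcset] by (auto simp: Pi_iff)
    then show ?thesis
      using B act_gen_commute[OF ab gh] by (auto simp: BijGroup_def compose_def fun_eq_iff)
  qed
  note l = group_BijGroup[of X] act_gen_hom comm
  show "act \<in> hom P (BijGroup X)"
    unfolding act_def by (rule lift_hom[OF l])
  show "act (incl u g) w = act_gen v u g w" if "u \<in> V" "g \<in> carrier (G u)" "w \<in> X" for u g w
    unfolding act_def by (subst lift_incl[OF l]) (use that in simp_all)
qed

lemma act_closed [simp]: "x \<in> carrier P \<Longrightarrow> w \<in> X \<Longrightarrow> act x w \<in> X"
  using hom_in_carrier[OF act_hom, of x] by (auto simp: BijGroup_def dest!: Bij_imp_funcset)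

lemma act_one: "w \<in> X \<Longrightarrow> act \<one>\<^bsub>P\<^esub> w = w"
  using hom_one[OF act_hom P.is_group group_BijGroup] by (simp add: BijGroup_def)

lemma act_mult:
  assumes "x \<in> carrier P" "y \<in> carrier P" "w \<in> X"
  shows "act (x \<otimes>\<^bsub>P\<^esub> y) w = act x (act y w)"
  using assms hom_mult[OF act_hom assms(1,2)] hom_in_carrier[OF act_hom]
  by (simp add: BijGroup_def compose_def)

lemma act_proj:
  assumes "x \<in> carrier P" "w \<in> X"
  shows "act (\<rho> x) w = translate (\<rho> x) w"
  using assms(1)
proof (induction rule: generator_induct)
  case one
  then show ?case using assms(2) by (simp add: act_one translate_one)
next
  case (incl u g y)
  have "translate (\<rho> y) w \<in> X"
    using incl assms(2) by (simp add: translate_closed)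
  then show ?case
    using incl assms(2)
    by (cases "u = v") (simp_all add: act_mult act_incl act_gen_def act_one translate_one translate_mult)
qed

abbreviation nf where "nf x \<equiv> act x []"

text \<open>
  P is the semidirect product of the kernel of the retraction with its image. Accordingly x acts
  by first translating with the image of x and then multiplying with the word of x.
\<close>

lemma act_eq_push_word:
  assumes "x \<in> carrier P" "z \<in> X"
  shows "act x z = push_word (G v) (nf x) (translate (\<rho> x) z)"
  using assms(1)
proof (induction rule: generator_induct)
  case one
  then show ?case using assms(2) by (simp add: act_one translate_one)
next
  case (incl u g y)
  have cl: "translate (\<rho> y) z \<in> X" using incl assms(2) by (simp add: translate_closed)
  show ?case
  proof (cases "u = v")
    case True
    then show ?thesis
      using incl assms(2) cl
      by (simp add: act_mult act_incl act_gen_def Gv.push_word_push[OF L_in_C] del: act_closed)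
        (simp add: act_incl act_gen_def Gv.push_word_push[OF L_in_C] Gv.push_word_reduced)
  next
    case False
    then show ?thesis
      using incl assms(2) cl
      by (simp add: act_mult act_incl act_gen_def translate_push_word translate_mult Gv.push_word_reduced)
  qed
qed

text \<open>
  The element of P for which the letter (c, p) stands: p conjugated by a representative of the
  coset c. The choice does not matter since L commutes with G_v (conj_letter_coset).
\<close>

definition conj_letter where
  "conj_letter c p = (let h = (SOME h. h \<in> c) in h \<otimes>\<^bsub>P\<^esub> incl v p \<otimes>\<^bsub>P\<^esub> inv\<^bsub>P\<^esub> h)"

definition word_value where
  "word_value w = foldr (\<lambda>(c, p) t. conj_letter c p \<otimes>\<^bsub>P\<^esub> t) w \<one>\<^bsub>P\<^esub>"

lemma word_value_simps [simp]:
  "word_value [] = \<one>\<^bsub>P\<^esub>"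
  "word_value ((c, p) # w) = conj_letter c p \<otimes>\<^bsub>P\<^esub> word_value w"
  by (simp_all add: word_value_def)

lemma conj_letter_coset:
  assumes h: "h \<in> carrier P" and p: "p \<in> carrier (G v)"
  shows "conj_letter (h <#\<^bsub>P\<^esub> L) p = h \<otimes>\<^bsub>P\<^esub> incl v p \<otimes>\<^bsub>P\<^esub> inv\<^bsub>P\<^esub> h"
proof -
  define k where "k = (SOME k. k \<in> h <#\<^bsub>P\<^esub> L)"
  have "k \<in> h <#\<^bsub>P\<^esub> L"
    unfolding k_def by (rule someI[of _ h]) (rule coset_self[OF h])
  then obtain y where k: "k = h \<otimes>\<^bsub>P\<^esub> y" and "y \<in> L"
    by (auto simp: l_coset_def)
  then have y: "y \<in> carrier P" "proj {u. (v, u) \<in> parcs \<Gamma>} y = y"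
    by (auto simp: link_subgroup_def)
  have "incl v p \<otimes>\<^bsub>P\<^esub> proj {u. (v, u) \<in> parcs \<Gamma>} y = proj {u. (v, u) \<in> parcs \<Gamma>} y \<otimes>\<^bsub>P\<^esub> incl v p"
    by (rule commuteI) (use v p y arcs_V in \<open>auto simp: incl_commute\<close>)
  then have "y \<otimes>\<^bsub>P\<^esub> incl v p = incl v p \<otimes>\<^bsub>P\<^esub> y"
    by (simp only: y(2))
  then have "y \<otimes>\<^bsub>P\<^esub> incl v p \<otimes>\<^bsub>P\<^esub> inv\<^bsub>P\<^esub> y = incl v p"
    using y(1) v p by (simp add: P.m_assoc)
  then have "h \<otimes>\<^bsub>P\<^esub> (y \<otimes>\<^bsub>P\<^esub> incl v p \<otimes>\<^bsub>P\<^esub> inv\<^bsub>P\<^esub> y) \<otimes>\<^bsub>P\<^esub> inv\<^bsub>P\<^esub> h = h \<otimes>\<^bsub>P\<^esub> incl v p \<otimes>\<^bsub>P\<^esub> inv\<^bsub>P\<^esub> h"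
    by (simp only:)
  then show ?thesis
    using y(1) h v p by (simp add: conj_letter_def Let_def k P.inv_mult_group P.m_assoc flip: k_def)
qed

lemma conj_letter_closed [simp]: "c \<in> C \<Longrightarrow> p \<in> carrier (G v) \<Longrightarrow> conj_letter c p \<in> carrier P"
  using v by (auto simp: link_cosets_def conj_letter_coset)

lemma word_value_closed [simp]: "w \<in> X \<Longrightarrow> word_value w \<in> carrier P"
  by (induction w) (auto simp: Cons_reduced)

lemma conj_letter_one: "c \<in> C \<Longrightarrow> conj_letter c \<one>\<^bsub>G v\<^esub> = \<one>\<^bsub>P\<^esub>"
  using v by (auto simp: link_cosets_def conj_letter_coset)

lemma conj_letter_mult:
  assumes "c \<in> C" "p \<in> carrier (G v)" "q \<in> carrier (G v)"
  shows "conj_letter c (p \<otimes>\<^bsub>G v\<^esub> q) = conj_letter c p \<otimes>\<^bsub>P\<^esub> conj_letter c q"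
proof -
  obtain h where h: "h \<in> carrier P" "c = h <#\<^bsub>P\<^esub> L" using assms(1) by (auto simp: link_cosets_def)
  have "inv\<^bsub>P\<^esub> h \<otimes>\<^bsub>P\<^esub> (h \<otimes>\<^bsub>P\<^esub> x) = x" if "x \<in> carrier P" for x
    using that h by (simp flip: P.m_assoc)
  then show ?thesis
    using h v assms by (simp add: conj_letter_coset incl_mult P.m_assoc)
qed

lemma word_value_push:
  assumes "c \<in> C" "p \<in> carrier (G v)" "w \<in> X"
  shows "word_value (push (G v) c p w) = conj_letter c p \<otimes>\<^bsub>P\<^esub> word_value w"
proof (cases w)
  case Nil
  then show ?thesis using assms by (simp add: push_def conj_letter_one)
next
  case (Cons l w')
  obtain d q where l: "l = (d, q)" by fastforce
  have d: "d \<in> C" "q \<in> carrier (G v)" "w' \<in> X" using assms(3) by (simp_all add: Cons l Cons_reduced)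
  have "conj_letter c p \<otimes>\<^bsub>P\<^esub> (conj_letter c q \<otimes>\<^bsub>P\<^esub> word_value w') = conj_letter c (p \<otimes>\<^bsub>G v\<^esub> q) \<otimes>\<^bsub>P\<^esub> word_value w'"
    using assms d by (simp add: conj_letter_mult P.m_assoc)
  then show ?thesis
    using assms d by (auto simp: Cons l push_def conj_letter_one)
qed

lemma word_value_translate:
  assumes h: "h \<in> carrier P" and "w \<in> X"
  shows "word_value (translate h w) \<otimes>\<^bsub>P\<^esub> h = h \<otimes>\<^bsub>P\<^esub> word_value w"
  using assms(2)
proof (induction w)
  case Nil
  then show ?case using h by (simp add: translate_def)
next
  case (Cons l w)
  obtain c p where l: "l = (c, p)" by fastforce
  have c: "c \<in> C" "p \<in> carrier (G v)" and w: "w \<in> X" using Cons.prems by (simp_all add: l Cons_reduced)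
  obtain k where k: "k \<in> carrier P" "c = k <#\<^bsub>P\<^esub> L" using c(1) by (auto simp: link_cosets_def)
  have "conj_letter (h <#\<^bsub>P\<^esub> c) p \<otimes>\<^bsub>P\<^esub> h = h \<otimes>\<^bsub>P\<^esub> conj_letter c p"
    using h k c v by (simp add: P.lcos_m_assoc L_subset conj_letter_coset P.inv_mult_group P.m_assoc)
  moreover have "translate h (l # w) = (h <#\<^bsub>P\<^esub> c, p) # translate h w"
    by (simp add: translate_def l)
  moreover have "translate h w \<in> X" "h <#\<^bsub>P\<^esub> c \<in> C"
    using h w c by (simp_all add: translate_closed coset_closed)
  ultimately show ?case
    using Cons.IH[OF w] h w c by (simp add: l P.m_assoc) (simp flip: P.m_assoc)
qed

text \<open>
  The word of x can be read back in P, and what remains of x is its image under the retraction.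
  This gives the faithfulness that is needed: an element with empty word is equal to its own
  retraction (nf_Nil).
\<close>

lemma decomposition:
  assumes "x \<in> carrier P"
  shows "x = word_value (nf x) \<otimes>\<^bsub>P\<^esub> \<rho> x"
  using assms
proof (induction rule: generator_induct)
  case one
  then show ?case by (simp add: act_one)
next
  case (incl u g y)
  have y: "nf y \<in> X" "\<rho> y \<in> carrier P" using incl by simp_all
  have gen: "incl u g \<in> carrier P" using incl by simp
  have *: "incl u g \<otimes>\<^bsub>P\<^esub> y = incl u g \<otimes>\<^bsub>P\<^esub> word_value (nf y) \<otimes>\<^bsub>P\<^esub> \<rho> y"
    using incl.IH y gen by (simp add: P.m_assoc)
  have "word_value (nf (incl u g \<otimes>\<^bsub>P\<^esub> y)) \<otimes>\<^bsub>P\<^esub> \<rho> (incl u g \<otimes>\<^bsub>P\<^esub> y)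
      = incl u g \<otimes>\<^bsub>P\<^esub> word_value (nf y) \<otimes>\<^bsub>P\<^esub> \<rho> y"
  proof (cases "u = v")
    case True
    have "conj_letter L g = incl v g"
      using conj_letter_coset[of "\<one>\<^bsub>P\<^esub>" g] incl True L_subset by (simp add: P.lcos_mult_one)
    then show ?thesis
      using incl.hyps True y by (simp add: act_mult act_incl act_gen_def word_value_push L_in_C)
  next
    case False
    have "incl u g \<otimes>\<^bsub>P\<^esub> word_value (nf y) = word_value (translate (incl u g) (nf y)) \<otimes>\<^bsub>P\<^esub> incl u g"
      by (rule word_value_translate[symmetric, OF gen y(1)])
    then show ?thesis
      using incl.hyps False y gen translate_closed[OF gen y(1)]
      by (simp add: act_mult act_incl act_gen_def P.m_assoc)
  qed
  then show ?case using * by (simp only:)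
qed

lemma nf_Nil: "x \<in> carrier P \<Longrightarrow> nf x = [] \<Longrightarrow> \<rho> x = x"
  using decomposition[of x] by simp

lemma push_Cons: "p \<noteq> \<one>\<^bsub>G v\<^esub> \<Longrightarrow> w = [] \<or> c \<noteq> fst (hd w) \<Longrightarrow> push (G v) c p w = (c, p) # w"
  by (auto simp: push_def split: list.split)

lemma hd_in_C: "w \<in> X \<Longrightarrow> w \<noteq> [] \<Longrightarrow> fst (hd w) \<in> C"
  using letters_in_C[of w "fst (hd w)" "snd (hd w)"] by simp

context
  fixes u
  assumes u: "u \<in> V" "u \<noteq> v" "(v, u) \<notin> parcs \<Gamma>"
    and nontrivial: "carrier (G u) \<noteq> {\<one>\<^bsub>G u\<^esub>}" "carrier (G v) \<noteq> {\<one>\<^bsub>G v\<^esub>}"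
begin

text \<open>
  A vertex u that is not joined to v moves the copy at L to another one, so that any given copy c
  can be avoided. The conjugates of G_v by 1 or by an element of G_u realise letters from one of
  these two copies.
\<close>

lemma obtain_letter:
  obtains d q y where "d \<in> C" "d \<noteq> c" "q \<in> carrier (G v)" "q \<noteq> \<one>\<^bsub>G v\<^esub>" "y \<in> carrier P"
    "\<And>w. w \<in> X \<Longrightarrow> act y w = push (G v) d q w"
    "\<And>w. w \<in> X \<Longrightarrow> act (inv\<^bsub>P\<^esub> y) w = push (G v) d (inv\<^bsub>G v\<^esub> q) w"
proof -
  interpret Gu: group "G u" by (rule groups[OF u(1)])
  obtain q where q: "q \<in> carrier (G v)" "q \<noteq> \<one>\<^bsub>G v\<^esub>" using nontrivial(2) Gv.one_closed by blast
  obtain g where g: "g \<in> carrier (G u)" "g \<noteq> \<one>\<^bsub>G u\<^esub>" using nontrivial(1) Gu.one_closed by blast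
  have "incl u g <#\<^bsub>P\<^esub> L \<noteq> L" using incl_coset_L[of u g] u g by simp
  moreover have "\<one>\<^bsub>P\<^esub> <#\<^bsub>P\<^esub> L = L" by (rule P.lcos_mult_one[OF L_subset])
  \<comment> \<open>The cosets of 1 and of incl u g are different, so one of them differs from
  c.\<close>
  ultimately have "\<exists>h. (h = \<one>\<^bsub>P\<^esub> \<or> h = incl u g) \<and> h <#\<^bsub>P\<^esub> L \<noteq> c" by metis
  then obtain h where "h = \<one>\<^bsub>P\<^esub> \<or> h = incl u g" and hL: "h <#\<^bsub>P\<^esub> L \<noteq> c" by blast
  then have h: "h \<in> carrier P" "\<rho> h = h" "\<rho> (inv\<^bsub>P\<^esub> h) = inv\<^bsub>P\<^esub> h"
    using u g by auto
  have act_y: "act (h \<otimes>\<^bsub>P\<^esub> incl v r \<otimes>\<^bsub>P\<^esub> inv\<^bsub>P\<^esub> h) w = push (G v) (h <#\<^bsub>P\<^esub> L) r w"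
    if r: "r \<in> carrier (G v)" and w: "w \<in> X" for r w
  proof -
    have "act (inv\<^bsub>P\<^esub> h) w = translate (inv\<^bsub>P\<^esub> h) w"
      using act_proj[of "inv\<^bsub>P\<^esub> h" w] h w by simp
    moreover have w': "translate (inv\<^bsub>P\<^esub> h) w \<in> X" using h w by (simp add: translate_closed)
    moreover have "act h z = translate h z" if "z \<in> X" for z
      using act_proj[of h z] h that by simp
    moreover have "push (G v) L r (translate (inv\<^bsub>P\<^esub> h) w) \<in> X"
      by (rule Gv.push_reduced[OF L_in_C r w'])
    ultimately show ?thesis
      using h v r w
      by (simp add: act_mult act_incl act_gen_def translate_push L_in_C flip: translate_mult)
        (simp add: translate_one)
  qed
  \<comment> \<open>Its inverse is the same conjugate of the inverse of q, so that it pushes the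
  inverse letter.\<close>
  let ?y = "h \<otimes>\<^bsub>P\<^esub> incl v q \<otimes>\<^bsub>P\<^esub> inv\<^bsub>P\<^esub> h"
  have "inv\<^bsub>P\<^esub> ?y = h \<otimes>\<^bsub>P\<^esub> incl v (inv\<^bsub>G v\<^esub> q) \<otimes>\<^bsub>P\<^esub> inv\<^bsub>P\<^esub> h"
    using h v q by (simp add: P.inv_mult_group incl_inv P.m_assoc)
  then show thesis
    using that[of "h <#\<^bsub>P\<^esub> L" q ?y] act_y q h hL v by (simp add: link_cosets_def)
qed

text \<open>
  If x is central and its word is not empty, take a letter y from a copy different from that of
  the first letter of this word. The word of y x has y in front and is longer. The word of x y has
  to be equally long, so there a translate of y was appended at the end, and the word still begins
  as that of x: a contradiction.
\<close>

lemma central_nf: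
  assumes x: "x \<in> carrier P" and comm: "\<And>y. y \<in> carrier P \<Longrightarrow> x \<otimes>\<^bsub>P\<^esub> y = y \<otimes>\<^bsub>P\<^esub> x"
  shows "nf x = []"
proof (rule ccontr)
  assume ne: "nf x \<noteq> []"
  obtain d q y where d: "d \<in> C" "d \<noteq> fst (hd (nf x))" and q: "q \<in> carrier (G v)" "q \<noteq> \<one>\<^bsub>G v\<^esub>"
    and y: "y \<in> carrier P" and act_y: "\<And>w. w \<in> X \<Longrightarrow> act y w = push (G v) d q w"
    by (rule obtain_letter[of "fst (hd (nf x))"]) (rule that)
  let ?l = "(\<rho> x <#\<^bsub>P\<^esub> d, q)"
  have yx: "nf (y \<otimes>\<^bsub>P\<^esub> x) = (d, q) # nf x"
    using x y q d by (simp add: act_mult act_y push_Cons)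
  have l: "[?l] \<in> X" "[(d, q)] \<in> X"
    using x d q by (simp_all add: Cons_reduced coset_closed)
  have "nf y = [(d, q)]" using q by (simp add: act_y push_Cons)
  then have xy: "nf (x \<otimes>\<^bsub>P\<^esub> y) = push_word (G v) (nf x) [?l]"
    using act_eq_push_word[OF x l(2)] x y by (simp add: act_mult translate_def)
  have eq: "push_word (G v) (nf x) [?l] = (d, q) # nf x"
    using xy yx comm[OF y] by simp
  show False
  proof (cases "fst (last (nf x)) = fst ?l")
    case True
    then have "length (push_word (G v) (nf x) [?l]) \<le> length (nf x)"
      using push_word_merge_length[OF ne, of "fst ?l"] by simp
    then show False by (simp add: eq)
  next
    case False
    then have "nf x @ [?l] \<in> X" using l x by (simp add: append_reduced)
    then have "nf x @ [?l] = (d, q) # nf x" using push_word_append eq by metis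
    then have "hd (nf x) = (d, q)" using ne by (metis hd_append2 list.sel(1))
    then show False using d by simp
  qed
qed

text \<open>
  Let m have a word of maximal length in M, and let h be its retraction. Suppose that the word is
  not empty. If the last copy is not h times the first copy, then the word of m m is twice as
  long. Otherwise, a letter y that avoids the first copy also avoids cancellation at the end of
  the word of m y^-1, and the word of y m y^-1 is longer by two letters.
\<close>

lemma bounded_normal_nf:
  assumes "M \<lhd> P" and bound: "\<And>x. x \<in> M \<Longrightarrow> length (nf x) \<le> B" and "x \<in> M"
  shows "nf x = []"
proof -
  interpret M: normal M P by fact
  obtain m where m: "m \<in> M" and max: "\<And>y. y \<in> M \<Longrightarrow> length (nf y) \<le> length (nf m)"
    using ex_has_greatest_nat[of "\<lambda>x. x \<in> M" x "\<lambda>x. length (nf x)" "Suc B"]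
      \<open>x \<in> M\<close> bound le_imp_less_Suc by metis
  have mP: "m \<in> carrier P" using m by (rule M.mem_carrier)
  let ?h = "\<rho> m"
  have "nf m = []"
  proof (rule ccontr)
    assume ne: "nf m \<noteq> []"
    let ?c = "fst (hd (nf m))"
    have c: "?c \<in> C" using ne mP by (simp add: hd_in_C)
    have last: "fst (last (nf m)) = ?h <#\<^bsub>P\<^esub> ?c"
    proof (rule ccontr)
      assume neq: "fst (last (nf m)) \<noteq> ?h <#\<^bsub>P\<^esub> ?c"
      have tX: "translate ?h (nf m) \<in> X" using mP by (simp add: translate_closed)
      have "fst (hd (translate ?h (nf m))) = ?h <#\<^bsub>P\<^esub> ?c"
        using ne by (simp add: translate_def hd_map)
      then have "nf m @ translate ?h (nf m) \<in> X"
        using mP neq tX by (simp add: append_reduced)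
      then have "nf (m \<otimes>\<^bsub>P\<^esub> m) = nf m @ translate ?h (nf m)"
        using act_eq_push_word[OF mP, of "nf m"] push_word_append mP by (simp add: act_mult)
      then have "length (nf (m \<otimes>\<^bsub>P\<^esub> m)) = length (nf m) + length (nf m)"
        by (simp add: translate_def)
      then show False using max[of "m \<otimes>\<^bsub>P\<^esub> m"] m ne by simp
    qed
    obtain d q y where d: "d \<in> C" "d \<noteq> ?c" and q: "q \<in> carrier (G v)" "q \<noteq> \<one>\<^bsub>G v\<^esub>"
      and y: "y \<in> carrier P" and act_y: "\<And>w. w \<in> X \<Longrightarrow> act y w = push (G v) d q w"
        "\<And>w. w \<in> X \<Longrightarrow> act (inv\<^bsub>P\<^esub> y) w = push (G v) d (inv\<^bsub>G v\<^esub> q) w"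
      by (rule obtain_letter[of ?c]) (rule that)
    have q': "inv\<^bsub>G v\<^esub> q \<in> carrier (G v)" "inv\<^bsub>G v\<^esub> q \<noteq> \<one>\<^bsub>G v\<^esub>"
      using q by (simp_all add: Gv.inv_eq_1_iff)
    let ?l = "(?h <#\<^bsub>P\<^esub> d, inv\<^bsub>G v\<^esub> q)"
    have l: "[?l] \<in> X" "[(d, inv\<^bsub>G v\<^esub> q)] \<in> X"
      using mP d q' by (simp_all add: Cons_reduced coset_closed)
    have "?h <#\<^bsub>P\<^esub> d \<noteq> ?h <#\<^bsub>P\<^esub> ?c"
      using inj_onD[OF coset_inj[of ?h] _ d(1) c] d(2) mP by auto
    then have ml: "nf m @ [?l] \<in> X"
      using mP l last by (simp add: append_reduced)
    have "nf (inv\<^bsub>P\<^esub> y) = [(d, inv\<^bsub>G v\<^esub> q)]"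
      using q' by (simp add: act_y push_Cons)
    then have "act m (nf (inv\<^bsub>P\<^esub> y)) = nf m @ [?l]"
      using act_eq_push_word[OF mP l(2)] push_word_append[OF ml] by (simp add: translate_def)
    then have "nf (y \<otimes>\<^bsub>P\<^esub> m \<otimes>\<^bsub>P\<^esub> inv\<^bsub>P\<^esub> y) = (d, q) # nf m @ [?l]"
      using mP y ml q d ne by (simp add: act_mult act_y(1) push_Cons)
    then show False
      using max[OF M.inv_op_closed2[OF y m]] by simp
  qed
  then show ?thesis using max[OF \<open>x \<in> M\<close>] by simp
qed

end

end

end

section \<open>Centre and finite normal subgroups of the automorphism group\<close>

locale graph_of_cyclic_groups = graph_of_groups \<Gamma> G
  for \<Gamma> :: "'v pair_pre_digraph" and G :: "'v \<Rightarrow> ('a, 'b) monoid_scheme" +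
  assumes nontrivial: "\<And>v. v \<in> pverts \<Gamma> \<Longrightarrow> \<not> trivial_group (G v)"
    and cyclic: "\<And>v. v \<in> pverts \<Gamma> \<Longrightarrow> cyclic_group (G v)"
begin

text \<open>
  The vertex set of the graph called Delta in the theorem.
\<close>

definition cone where "cone = {v \<in> V. star \<Gamma> v = V}"

lemma cone_V: "v \<in> cone \<Longrightarrow> v \<in> V"
  by (simp add: cone_def)

lemma cone_subset: "cone \<subseteq> V"
  by (auto simp: cone_def)

lemma cone_arc: "v \<in> cone \<Longrightarrow> u \<in> V \<Longrightarrow> u \<noteq> v \<Longrightarrow> (v, u) \<in> parcs \<Gamma>"
  by (auto simp: cone_def star_def)

lemma not_cone_obtain:
  assumes "v \<in> V - cone"
  obtains u where "u \<in> V" "u \<noteq> v" "(v, u) \<notin> parcs \<Gamma>"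
  using assms by (auto simp: cone_def star_def)

lemma nontrivial_carrier: "v \<in> V \<Longrightarrow> carrier (G v) \<noteq> {\<one>\<^bsub>G v\<^esub>}"
  using nontrivial[of v] groups[of v] by (auto simp: trivial_group_def)

lemma incl_cone_centre:
  assumes u: "u \<in> cone" and g: "g \<in> carrier (G u)"
  shows "incl u g \<in> P.centre"
proof (rule P.centreI)
  have uV: "u \<in> V" using u by (rule cone_V)
  interpret Gu: comm_group "G u"
    by (rule group.cyclic_imp_abelian_group[OF groups[OF uV] cyclic[OF uV]])
  show "incl u g \<in> carrier P" using uV g by simp
  show "incl u g \<otimes>\<^bsub>P\<^esub> y = y \<otimes>\<^bsub>P\<^esub> incl u g" if y: "y \<in> carrier P" for y
  proof -
    have "incl u g \<otimes>\<^bsub>P\<^esub> proj V y = proj V y \<otimes>\<^bsub>P\<^esub> incl u g"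
    proof (rule commuteI)
      show "incl u g \<otimes>\<^bsub>P\<^esub> incl w h = incl w h \<otimes>\<^bsub>P\<^esub> incl u g"
        if "w \<in> V" "h \<in> carrier (G w)" for w h
        using that uV g cone_arc[OF u, of w] incl_commute[of u w g h]
        by (cases "w = u") (simp_all add: Gu.m_comm flip: incl_mult)
    qed (use uV g y in auto)
    then show ?thesis using y by (simp add: proj_superset)
  qed
qed

lemma proj_cone_centre:
  assumes "U \<subseteq> cone" and x: "x \<in> carrier P"
  shows "proj U x \<in> P.centre"
proof (rule P.centreI)
  show "proj U x \<otimes>\<^bsub>P\<^esub> y = y \<otimes>\<^bsub>P\<^esub> proj U x" if y: "y \<in> carrier P" for y
  proof (rule commuteI[OF y x, symmetric])
    show "y \<otimes>\<^bsub>P\<^esub> incl u g = incl u g \<otimes>\<^bsub>P\<^esub> y" if "u \<in> U" "g \<in> carrier (G u)" for u g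
      by (rule P.centre_commute[OF incl_cone_centre y, symmetric]) (use that assms(1) in auto)
  qed (use assms(1) cone_subset in auto)
qed (use x in simp)

text \<open>
  A central element has an empty word with respect to each non-cone vertex v, hence lies in all
  the subgroups P_(V - v), and so in their intersection P_D.
\<close>

lemma centre_eq: "P.centre = {x \<in> carrier P. proj cone x = x}"
proof (intro equalityI subsetI)
  fix x assume x: "x \<in> P.centre"
  then have xP: "x \<in> carrier P" by simp
  have "proj cone x = x"
  proof (rule proj_fixed_Int[OF xP cone_subset])
    fix v assume v: "v \<in> V - cone"
    obtain u where u: "u \<in> V" "u \<noteq> v" "(v, u) \<notin> parcs \<Gamma>" by (rule not_cone_obtain[OF v])
    have "act v x [] = []"
      by (rule central_nf[OF _ u nontrivial_carrier nontrivial_carrier xP P.centre_commute[OF x]])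
        (use u v in auto)
    then show "proj (V - {v}) x = x" using nf_Nil[of v x] v xP by simp
  qed
  then show "x \<in> {x \<in> carrier P. proj cone x = x}" using xP by simp
next
  fix x assume "x \<in> {x \<in> carrier P. proj cone x = x}"
  then show "x \<in> P.centre" using proj_cone_centre[OF subset_refl, of x] by simp
qed

text \<open>
  The set S of elements whose inner automorphism lies in N need not be finite, since it contains
  the centre. But central elements have empty words, and therefore the word of y depends on the
  inner automorphism of y only. The lengths on S are thus bounded by their maximum over N.
\<close>

lemma finite_normal_autos_displacement:
  assumes N: "N \<lhd> AutoGroup P" and fin: "finite N" and n: "n \<in> N" and g: "g \<in> carrier P"
  shows "n g \<otimes>\<^bsub>P\<^esub> inv\<^bsub>P\<^esub> g \<in> P.centre"
proof -
  define S where "S = {x \<in> carrier P. P.inner x \<in> N}"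
  have S: "S \<lhd> P" unfolding S_def by (rule P.normal_inner_vimage[OF N])
  have "S \<subseteq> P.centre"
  proof
    fix x assume x: "x \<in> S"
    then have xP: "x \<in> carrier P" by (simp add: S_def)
    have "proj cone x = x"
    proof (rule proj_fixed_Int[OF xP cone_subset])
      fix v assume v: "v \<in> V - cone"
      then have vV: "v \<in> V" by simp
      obtain u where u: "u \<in> V" "u \<noteq> v" "(v, u) \<notin> parcs \<Gamma>" by (rule not_cone_obtain[OF v])
      have same: "act v y [] = act v z []"
        if yz: "y \<in> carrier P" "z \<in> carrier P" and eq: "P.inner y = P.inner z" for y z
      proof -
        let ?c = "inv\<^bsub>P\<^esub> y \<otimes>\<^bsub>P\<^esub> z"
        have c: "?c \<in> P.centre" by (rule P.inner_eq_centre[OF yz eq])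
        have "act v ?c [] = []"
          by (rule central_nf[OF vV u nontrivial_carrier[OF u(1)] nontrivial_carrier[OF vV]
                P.centre_closed[OF c] P.centre_commute[OF c]])
        moreover have "y \<otimes>\<^bsub>P\<^esub> ?c = z" using yz by (simp flip: P.m_assoc)
        ultimately show ?thesis
          using act_mult[OF vV yz(1) P.centre_closed[OF c], of "[]"] by simp
      qed
      \<comment> \<open>Well defined on inner automorphisms by the preceding fact.\<close>
      define l where "l \<alpha> = length (act v (SOME y. y \<in> carrier P \<and> P.inner y = \<alpha>) [])" for \<alpha>
      have l: "length (act v y []) = l (P.inner y)" if "y \<in> carrier P" for y
      proof -
        have "\<exists>z. z \<in> carrier P \<and> P.inner z = P.inner y" using that by blast
        from someI_ex[OF this] show ?thesis
          unfolding l_def by (intro arg_cong[where f = length] same that) auto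
      qed
      have bound: "length (act v y []) \<le> Max (l ` N)" if "y \<in> S" for y
        using that fin l by (simp add: S_def)
      have "act v x [] = []"
        by (rule bounded_normal_nf[OF vV u nontrivial_carrier[OF u(1)] nontrivial_carrier[OF vV] S bound x])
      then show "proj (V - {v}) x = x" using nf_Nil[OF vV xP] by simp
    qed
    then show "x \<in> P.centre" using xP unfolding centre_eq by blast
  qed
  moreover have "n g \<otimes>\<^bsub>P\<^esub> inv\<^bsub>P\<^esub> g \<in> S"
  proof -
    have "n \<in> auto P" using normal.axioms(1)[OF N] n by (auto dest: subgroup.mem_carrier)
    then show ?thesis using P.inner_displacement[OF N n g] g by (simp add: S_def)
  qed
  ultimately show ?thesis by blast
qed

lemma proj_centre: "x \<in> P.centre \<Longrightarrow> proj cone x = x"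
  unfolding centre_eq by blast

lemma split_cone_coordinate:
  assumes v: "v \<in> cone" and x: "x \<in> carrier P"
  shows "x = proj {v} x \<otimes>\<^bsub>P\<^esub> proj (V - {v}) x"
proof (rule hom_eqI[OF P.is_group _ _ _ x, of "\<lambda>x. x" "\<lambda>x. proj {v} x \<otimes>\<^bsub>P\<^esub> proj (V - {v}) x"])
  show "(\<lambda>x. proj {v} x \<otimes>\<^bsub>P\<^esub> proj (V - {v}) x) \<in> hom P P"
    by (rule P.hom_mult_centre[OF proj_hom proj_hom]) (use v in \<open>simp add: proj_cone_centre\<close>)
qed (auto simp: hom_def)

text \<open>
  The coordinates of cone vertices are central and can be split off. So a central element without
  such coordinates lies in P_(V - v) for all vertices v, that is, in the trivial group.
\<close>

lemma centre_coord_eq_one: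
  assumes x: "x \<in> P.centre" and "\<And>v. v \<in> cone \<Longrightarrow> coord v x = \<one>\<^bsub>G v\<^esub>"
  shows "x = \<one>\<^bsub>P\<^esub>"
proof -
  have xP: "x \<in> carrier P" using x by simp
  have "proj {} x = x"
  proof (rule proj_fixed_Int[OF xP])
    fix v assume v: "v \<in> V - {}"
    show "proj (V - {v}) x = x"
    proof (cases "v \<in> cone")
      case True
      have "proj {v} x = \<one>\<^bsub>P\<^esub>"
        using incl_coord[of v x] v xP assms(2)[OF True] by simp
      then show ?thesis using split_cone_coordinate[OF True xP] xP by simp
    next
      case False
      then have "(V - {v}) \<inter> cone = cone" using cone_subset by auto
      then show ?thesis using proj_proj[OF xP, of "V - {v}" cone] proj_centre[OF x] by simp
    qed
  qed simp
  then show ?thesis using xP proj_disjoint[OF xP, of "{}"] by simp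
qed

lemma centre_inj_coord:
  assumes "x \<in> P.centre" "y \<in> P.centre" and eq: "\<And>v. v \<in> cone \<Longrightarrow> coord v x = coord v y"
  shows "x = y"
proof -
  interpret Z: subgroup P.centre P by (rule P.subgroup_centre)
  have xy: "x \<in> carrier P" "y \<in> carrier P" using assms by simp_all
  have "x \<otimes>\<^bsub>P\<^esub> inv\<^bsub>P\<^esub> y = \<one>\<^bsub>P\<^esub>"
  proof (rule centre_coord_eq_one)
    fix v assume v: "v \<in> cone"
    interpret c: group_hom P "G v" "coord v"
      using cone_V[OF v] coord_hom groups P.is_group by (simp add: group_hom_def group_hom_axioms_def)
    show "coord v (x \<otimes>\<^bsub>P\<^esub> inv\<^bsub>P\<^esub> y) = \<one>\<^bsub>G v\<^esub>" using xy eq[OF v] by simp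
  qed (use assms in simp)
  then show ?thesis using xy by (simp add: P.inv_solve_right')
qed

section \<open>Triviality of finite normal subgroups\<close>

lemma normal_autos_auto: "N \<lhd> AutoGroup P \<Longrightarrow> n \<in> N \<Longrightarrow> n \<in> auto P"
  using normal_imp_subgroup[of N "AutoGroup P"] by (auto dest: subgroup.mem_carrier)

lemma auto_eq_one_on_generators:
  assumes n: "n \<in> auto P" and "\<And>u g. u \<in> V \<Longrightarrow> g \<in> carrier (G u) \<Longrightarrow> n (incl u g) = incl u g"
  shows "n = \<one>\<^bsub>AutoGroup P\<^esub>"
proof (rule P.auto_eq_one[OF n])
  show "n x = x" if "x \<in> carrier P" for x
    by (rule hom_eqI[OF P.is_group P.auto_hom[OF n], of "\<lambda>x. x"])
      (use assms(2) that in \<open>auto simp: hom_def\<close>)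
qed

lemma displacement_one:
  "n \<in> auto P \<Longrightarrow> x \<in> carrier P \<Longrightarrow> n x \<otimes>\<^bsub>P\<^esub> inv\<^bsub>P\<^esub> x = \<one>\<^bsub>P\<^esub> \<Longrightarrow> n x = x"
  using P.inv_solve_right'[of "\<one>\<^bsub>P\<^esub>" "n x" x] by simp

lemma displacement_mult: "n \<in> auto P \<Longrightarrow> x \<in> carrier P \<Longrightarrow> n x \<otimes>\<^bsub>P\<^esub> inv\<^bsub>P\<^esub> x \<otimes>\<^bsub>P\<^esub> x = n x"
  by (simp add: P.m_assoc)

lemma finite_normal_trivial_no_cone:
  assumes N: "N \<lhd> AutoGroup P" "finite N" and "cone = {}" and n: "n \<in> N"
  shows "n = \<one>\<^bsub>AutoGroup P\<^esub>"
proof (rule P.auto_eq_one[OF normal_autos_auto[OF N(1) n]])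
  fix x assume x: "x \<in> carrier P"
  have "n x \<otimes>\<^bsub>P\<^esub> inv\<^bsub>P\<^esub> x = \<one>\<^bsub>P\<^esub>"
    by (rule centre_coord_eq_one[OF finite_normal_autos_displacement[OF N n x]]) (use assms(3) in simp)
  then show "n x = x" by (rule displacement_one[OF normal_autos_auto[OF N(1) n] x])
qed

text \<open>
  The displacement homomorphism takes values in a group of order 2, and so kills elements of odd
  order. On the centre, an automorphism fixes the only nontrivial element.
\<close>

lemma finite_normal_trivial_involution_cone:
  assumes N: "N \<lhd> AutoGroup P" "finite N" and cone: "cone = {a}" and card: "card (carrier (G a)) = 2"
    and odd: "\<And>w. w \<in> V - {a} \<Longrightarrow> finite (carrier (G w)) \<and> odd (order (G w))" and n: "n \<in> N"
  shows "n = \<one>\<^bsub>AutoGroup P\<^esub>"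
proof (rule auto_eq_one_on_generators)
  show n': "n \<in> auto P" by (rule normal_autos_auto[OF N(1) n])
  have a: "a \<in> V" using cone cone_V by blast
  interpret Ga: group "G a" by (rule groups[OF a])
  obtain s where s: "carrier (G a) = {\<one>\<^bsub>G a\<^esub>, s}" "s \<noteq> \<one>\<^bsub>G a\<^esub>" by (rule Ga.order_two_carrier[OF card])
  have ss: "s \<otimes>\<^bsub>G a\<^esub> s = \<one>\<^bsub>G a\<^esub>"
    using s Ga.m_closed[of s s] Ga.l_cancel_one[of s s] by auto
  have centre: "z = \<one>\<^bsub>P\<^esub> \<or> z = incl a s" if z: "z \<in> P.centre" for z
  proof -
    have zP: "z \<in> carrier P" using z by simp
    have "z = incl a (coord a z)"
      using proj_centre[OF z] incl_coord[OF a zP] cone by simp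
    moreover have "coord a z \<in> {\<one>\<^bsub>G a\<^esub>, s}"
      using hom_in_carrier[OF coord_hom[OF a] zP] s(1) by simp
    ultimately show ?thesis using incl_one[OF a] by auto
  qed
  have "incl a s \<otimes>\<^bsub>P\<^esub> incl a s = \<one>\<^bsub>P\<^esub>"
    using incl_mult[OF a, of s s, symmetric] s(1) ss a by simp
  then have square: "z \<otimes>\<^bsub>P\<^esub> z = \<one>\<^bsub>P\<^esub>" if "z \<in> P.centre" for z
    using centre[OF that] by (elim disjE) simp_all
  let ?f = "\<lambda>x. n x \<otimes>\<^bsub>P\<^esub> inv\<^bsub>P\<^esub> x"
  have f_centre: "?f x \<in> P.centre" if "x \<in> carrier P" for x
    by (rule finite_normal_autos_displacement[OF N n that])
  interpret f: group_hom P P ?f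
    by unfold_locales (rule P.displacement_hom[OF P.auto_hom[OF n'] f_centre])
  fix u g assume u: "u \<in> V" and g: "g \<in> carrier (G u)"
  have x: "incl u g \<in> carrier P" using u g by simp
  show "n (incl u g) = incl u g"
  proof (cases "u = a")
    case True
    interpret n: group_hom P P n by (rule P.auto_group_hom[OF n'])
    have c: "incl a g \<in> P.centre" using g True cone by (auto intro: incl_cone_centre)
    then have "n (incl a g) \<in> P.centre" by (rule P.auto_centre[OF n'])
    then have "n (incl a g) = \<one>\<^bsub>P\<^esub> \<or> n (incl a g) = incl a s" by (rule centre)
    moreover have "n (incl a g) \<noteq> \<one>\<^bsub>P\<^esub>" if "incl a g \<noteq> \<one>\<^bsub>P\<^esub>"
      using P.auto_inj[OF n', of "incl a g" "\<one>\<^bsub>P\<^esub>"] that c by auto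
    ultimately show ?thesis using centre[OF c] True by auto
  next
    case False
    interpret Gu: group "G u" by (rule groups[OF u])
    interpret i: group_hom "G u" P "incl u"
      using incl_hom[OF u] by unfold_locales
    have "g [^]\<^bsub>G u\<^esub> order (G u) = \<one>\<^bsub>G u\<^esub>" by (rule Gu.pow_order_eq_1[OF g])
    then have "incl u g [^]\<^bsub>P\<^esub> order (G u) = \<one>\<^bsub>P\<^esub>"
      using i.hom_nat_pow[OF g, of "order (G u)"] u by simp
    then have "?f (incl u g) [^]\<^bsub>P\<^esub> order (G u) = \<one>\<^bsub>P\<^esub>"
      using f.hom_nat_pow[OF x, of "order (G u)"] f.hom_one by simp
    then have "?f (incl u g) = \<one>\<^bsub>P\<^esub>"
      using P.odd_exponent_involution[OF _ square[OF f_centre[OF x]]] odd[of u] u False f_centre[OF x] by auto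
    then show ?thesis by (rule displacement_one[OF n' x])
  qed
qed

lemma centre_torsion_free:
  assumes inf: "\<And>v. v \<in> cone \<Longrightarrow> infinite (carrier (G v))"
    and z: "z \<in> P.centre" "z [^]\<^bsub>P\<^esub> (j::nat) = \<one>\<^bsub>P\<^esub>" "j > 0"
  shows "z = \<one>\<^bsub>P\<^esub>"
proof (rule centre_coord_eq_one[OF z(1)])
  fix v assume v: "v \<in> cone"
  then have vV: "v \<in> V" by (rule cone_V)
  interpret c: group_hom P "G v" "coord v"
    using vV coord_hom groups P.is_group by (simp add: group_hom_def group_hom_axioms_def)
  have "coord v z [^]\<^bsub>G v\<^esub> j = \<one>\<^bsub>G v\<^esub>"
    using c.hom_nat_pow[of z j] z by simp
  then show "coord v z = \<one>\<^bsub>G v\<^esub>"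
    using c.H.infinite_cyclic_torsion_free[OF cyclic[OF vV] inf[OF v]] z by simp
qed

text \<open>
  If m x = e x with e central and m fixes the centre, then m^k x = e^k x. As m has finite order, e
  is a torsion element of the centre, which is torsion-free.
\<close>

lemma fixes_centre_imp_one:
  assumes inf: "\<And>v. v \<in> cone \<Longrightarrow> infinite (carrier (G v))"
    and N: "N \<lhd> AutoGroup P" "finite N" and m: "m \<in> N" and fix_c: "\<And>z. z \<in> P.centre \<Longrightarrow> m z = z"
  shows "m = \<one>\<^bsub>AutoGroup P\<^esub>"
proof (rule P.auto_eq_one)
  interpret A: group "AutoGroup P" by (rule P.AutoGroup)
  interpret N: normal N "AutoGroup P" by (rule N(1))
  interpret Z: subgroup P.centre P by (rule P.subgroup_centre)
  show m': "m \<in> auto P" by (rule normal_autos_auto[OF N(1) m])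
  interpret m: group_hom P P m by (rule P.auto_group_hom[OF m'])
  fix x assume x: "x \<in> carrier P"
  define e where "e = m x \<otimes>\<^bsub>P\<^esub> inv\<^bsub>P\<^esub> x"
  have e: "e \<in> P.centre" unfolding e_def by (rule finite_normal_autos_displacement[OF N m x])
  have mx: "m x = e \<otimes>\<^bsub>P\<^esub> x" using displacement_mult[OF m' x] by (simp add: e_def)
  have e_pow: "e [^]\<^bsub>P\<^esub> k \<in> P.centre" for k :: nat
    using e by (induction k) auto
  have pow: "m [^]\<^bsub>AutoGroup P\<^esub> k \<in> auto P \<and> (m [^]\<^bsub>AutoGroup P\<^esub> k) x = e [^]\<^bsub>P\<^esub> k \<otimes>\<^bsub>P\<^esub> x" for k :: nat
  proof (induction k)
    case 0
    then show ?case using x by (simp add: P.AutoGroup_one)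
  next
    case (Suc k)
    have c: "e [^]\<^bsub>P\<^esub> k \<in> carrier P" "e \<in> carrier P" using e_pow e by auto
    have "(m [^]\<^bsub>AutoGroup P\<^esub> Suc k) x = m ((m [^]\<^bsub>AutoGroup P\<^esub> k) x)"
      using Suc m' x A.nat_pow_Suc2[of m k] by (simp add: P.AutoGroup_mult)
    also have "\<dots> = m (e [^]\<^bsub>P\<^esub> k \<otimes>\<^bsub>P\<^esub> x)" using Suc by simp
    also have "\<dots> = e [^]\<^bsub>P\<^esub> k \<otimes>\<^bsub>P\<^esub> (e \<otimes>\<^bsub>P\<^esub> x)" using c x fix_c[OF e_pow] mx by simp
    also have "\<dots> = e [^]\<^bsub>P\<^esub> Suc k \<otimes>\<^bsub>P\<^esub> x" using c x by (simp add: P.m_assoc)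
    finally show ?case using Suc m' by simp
  qed
  interpret NG: group "(AutoGroup P)\<lparr>carrier := N\<rparr>" by (rule A.subgroup_imp_group[OF N.is_subgroup])
  have "m [^]\<^bsub>AutoGroup P\<^esub> card N = \<one>\<^bsub>AutoGroup P\<^esub>"
    using NG.pow_order_eq_1[of m] m A.nat_pow_consistent[of m "card N" N] by (simp add: order_def)
  then have "e [^]\<^bsub>P\<^esub> card N \<otimes>\<^bsub>P\<^esub> x = x" using pow[of "card N"] x by (simp add: P.AutoGroup_one)
  then have "e [^]\<^bsub>P\<^esub> card N = \<one>\<^bsub>P\<^esub>" using e_pow[of "card N"] x P.r_cancel_one'[of "e [^]\<^bsub>P\<^esub> card N" x] P.centre_closed by auto
  moreover have "card N > 0" using m N(2) by (auto simp: card_gt_0_iff)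
  ultimately have "e = \<one>\<^bsub>P\<^esub>" using centre_torsion_free[OF inf e] by blast
  then show "m x = x" using mx x by simp
qed

text \<open>
  The homomorphism f that sends the generator t of G_w to a central element a and kills the other
  vertex groups. If a has no component in G_w, then f kills its own image. The last property says
  that the image of f is generated by a, in the form in which it is used.
\<close>

lemma obtain_central_transvection:
  assumes w: "w \<in> V" and t: "t \<in> carrier (G w)" "carrier (G w) = range (\<lambda>n::int. t [^]\<^bsub>G w\<^esub> n)"
    and a: "a \<in> P.centre" and a_w: "proj {w} a = \<one>\<^bsub>P\<^esub>"
    and rel: "\<And>i::int. t [^]\<^bsub>G w\<^esub> i = \<one>\<^bsub>G w\<^esub> \<Longrightarrow> a [^]\<^bsub>P\<^esub> i = \<one>\<^bsub>P\<^esub>"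
  obtains f where "f \<in> hom P P" "f (incl w t) = a" "(\<lambda>x\<in>carrier P. f x \<otimes>\<^bsub>P\<^esub> x) \<in> auto P"
    "\<And>x. x \<in> carrier P \<Longrightarrow> proj {w} x = \<one>\<^bsub>P\<^esub> \<Longrightarrow> f x = \<one>\<^bsub>P\<^esub>"
    "\<And>M x. subgroup M P \<Longrightarrow> a \<in> M \<Longrightarrow> x \<in> carrier P \<Longrightarrow> f x \<in> M"
proof -
  interpret Gw: group "G w" by (rule groups[OF w])
  have aP: "a \<in> carrier P" using a by simp
  obtain h where h: "h \<in> hom (G w) P" "\<And>i::int. h (t [^]\<^bsub>G w\<^esub> i) = a [^]\<^bsub>P\<^esub> i"
    by (rule Gw.cyclic_hom[OF t P.is_group aP rel], assumption) (rule that)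
  let ?\<phi> = "\<lambda>u g. if u = w then h g else \<one>\<^bsub>P\<^esub>"
  have hom: "?\<phi> u \<in> hom (G u) P" if "u \<in> V" for u
    using h(1) trivial_hom_P[OF that] by (cases "u = w") auto
  have comm: "?\<phi> b g \<otimes>\<^bsub>P\<^esub> ?\<phi> c k = ?\<phi> c k \<otimes>\<^bsub>P\<^esub> ?\<phi> b g"
    if "(b, c) \<in> parcs \<Gamma>" "g \<in> carrier (G b)" "k \<in> carrier (G c)" for b c g k
    using that arcs_irrefl hom_in_carrier[OF h(1)] by auto
  define f where "f = lift P ?\<phi>"
  have f_hom: "f \<in> hom P P" unfolding f_def by (rule lift_hom[OF P.is_group hom comm])
  have f_incl: "f (incl u g) = ?\<phi> u g" if "u \<in> V" "g \<in> carrier (G u)" for u g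
    unfolding f_def by (rule lift_incl[OF P.is_group hom comm that])
  interpret f: group_hom P P f by unfold_locales (rule f_hom)
  have f_proj: "f (proj {w} x) = f x" if "x \<in> carrier P" for x
  proof -
    have "(f \<circ> proj {w}) x = f x"
      by (rule hom_eqI[OF P.is_group hom_compose[OF proj_hom f_hom] f_hom _ that]) (auto simp: f_incl w)
    then show ?thesis by simp
  qed
  have f_one: "f x = \<one>\<^bsub>P\<^esub>" if "x \<in> carrier P" "proj {w} x = \<one>\<^bsub>P\<^esub>" for x
    using f_proj[OF that(1)] that(2) by simp
  have f_in: "f x \<in> M" if M: "subgroup M P" "a \<in> M" and x: "x \<in> carrier P" for M x
    using x
  proof (induction rule: generator_induct)
    interpret M: subgroup M P by fact
    case one
    then show ?case by simp
  next
    interpret M: subgroup M P by fact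
    case (incl u g y)
    have "f (incl u g) \<in> M"
    proof (cases "u = w")
      case True
      then obtain i :: int where "g = t [^]\<^bsub>G w\<^esub> i" using incl(2) t(2) by blast
      then have "f (incl u g) = a [^]\<^bsub>P\<^esub> i" using True f_incl[OF w] incl(2) h(2) by simp
      then show ?thesis using P.subgroup_int_pow_closed[OF M] by simp
    qed (use incl f_incl in simp)
    then show ?case using incl by simp
  qed
  have f_centre: "f x \<in> P.centre" if "x \<in> carrier P" for x
    by (rule f_in[OF P.subgroup_centre a that])
  have ff: "f (f x) = \<one>\<^bsub>P\<^esub>" if x: "x \<in> carrier P" for x
  proof (rule f_one)
    have "f x \<in> kernel P P (proj {w})"
      by (rule f_in[OF proj.subgroup_kernel _ x]) (use a_w aP in \<open>simp add: kernel_def\<close>)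
    then show "proj {w} (f x) = \<one>\<^bsub>P\<^esub>" by (simp add: kernel_def)
  qed (use x in simp)
  show thesis
  proof (rule that[OF f_hom])
    show "f (incl w t) = a"
      using f_incl[OF w t(1)] h(2)[of 1] t(1) aP by simp
    show "(\<lambda>x\<in>carrier P. f x \<otimes>\<^bsub>P\<^esub> x) \<in> auto P"
      by (rule P.transvection_auto[OF f_hom f_centre ff])
  qed (fact f_one f_in)+
qed

lemma finite_normal_trivial_infinite_vertex:
  assumes inf: "\<And>v. v \<in> cone \<Longrightarrow> infinite (carrier (G v))"
    and w: "w \<in> V - cone" "infinite (carrier (G w))"
    and N: "N \<lhd> AutoGroup P" "finite N" and n: "n \<in> N"
  shows "n = \<one>\<^bsub>AutoGroup P\<^esub>"
proof (rule fixes_centre_imp_one[OF inf N n])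
  interpret A: group "AutoGroup P" by (rule P.AutoGroup)
  interpret N: normal N "AutoGroup P" by (rule N(1))
  fix a assume a: "a \<in> P.centre"
  have wV: "w \<in> V" using w by simp
  interpret Gw: group "G w" by (rule groups[OF wV])
  have n': "n \<in> auto P" by (rule normal_autos_auto[OF N(1) n])
  interpret n: group_hom P P n by (rule P.auto_group_hom[OF n'])
  have proj_w: "proj {w} z = \<one>\<^bsub>P\<^esub>" if z: "z \<in> P.centre" for z
  proof -
    have "proj {w} (proj cone z) = proj ({w} \<inter> cone) z" using z by (simp add: proj_proj)
    then show ?thesis using w(1) z proj_centre[OF z] by (simp add: proj_disjoint)
  qed
  obtain t where t: "t \<in> carrier (G w)" "carrier (G w) = range (\<lambda>n::int. t [^]\<^bsub>G w\<^esub> n)"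
    by (rule Gw.cyclic_generator[OF cyclic[OF wV]])
  have rel: "a [^]\<^bsub>P\<^esub> i = \<one>\<^bsub>P\<^esub>" if "t [^]\<^bsub>G w\<^esub> i = \<one>\<^bsub>G w\<^esub>" for i :: int
    using that Gw.int_pow_eq_id[OF t(1), of i] Gw.cyclic_generator_ord[OF t] w(2) by simp
  obtain f where f: "f \<in> hom P P" "f (incl w t) = a" and \<tau>: "(\<lambda>x\<in>carrier P. f x \<otimes>\<^bsub>P\<^esub> x) \<in> auto P"
    and f_one: "\<And>x. x \<in> carrier P \<Longrightarrow> proj {w} x = \<one>\<^bsub>P\<^esub> \<Longrightarrow> f x = \<one>\<^bsub>P\<^esub>"
    by (rule obtain_central_transvection[OF wV t a proj_w[OF a] rel], assumption) (rule that)
  interpret f: group_hom P P f by unfold_locales (rule f)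
  \<comment> \<open>The transvection sends t to a t and fixes the centre.\<close>
  define \<tau>' where "\<tau>' = (\<lambda>x\<in>carrier P. f x \<otimes>\<^bsub>P\<^esub> x)"
  have \<tau>': "\<tau>' \<in> auto P" using \<tau> by (simp add: \<tau>'_def)
  have \<tau>_centre: "\<tau>' z = z" if "z \<in> P.centre" for z
    using that f_one[OF _ proj_w] by (simp add: \<tau>'_def)
  let ?n' = "inv\<^bsub>AutoGroup P\<^esub> n" and ?i = "inv\<^bsub>AutoGroup P\<^esub> \<tau>'"
  let ?m = "n \<otimes>\<^bsub>AutoGroup P\<^esub> (\<tau>' \<otimes>\<^bsub>AutoGroup P\<^esub> ?n' \<otimes>\<^bsub>AutoGroup P\<^esub> ?i)"
  have m_eq: "?m x = n (\<tau>' (?n' (?i x)))" if "x \<in> carrier P" for x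
    using that n' \<tau>' by (simp add: P.AutoGroup_mult)
  \<comment> \<open>The commutator of n with the transvection lies in N and fixes the centre
  pointwise.\<close>
  have "?m = \<one>\<^bsub>AutoGroup P\<^esub>"
  proof (rule fixes_centre_imp_one[OF inf N])
    show "?m \<in> N" using N.inv_op_closed2[of \<tau>' ?n'] n \<tau>' by simp
    fix z assume z: "z \<in> P.centre"
    have "?i z = z" using P.inv_auto_left[OF \<tau>', of z] \<tau>_centre[OF z] z by simp
    moreover have "\<tau>' (?n' z) = ?n' z" by (rule \<tau>_centre[OF P.auto_centre[OF P.inv_auto[OF n'] z]])
    ultimately show "?m z = z" using z n' m_eq[of z] by (simp add: P.inv_auto_right)
  qed
  let ?t = "incl w t"
  define e where "e = n ?t \<otimes>\<^bsub>P\<^esub> inv\<^bsub>P\<^esub> ?t"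
  have tP: "?t \<in> carrier P" using wV t by simp
  have e: "e \<in> P.centre" unfolding e_def by (rule finite_normal_autos_displacement[OF N n tP])
  have nt: "n ?t = e \<otimes>\<^bsub>P\<^esub> ?t" using displacement_mult[OF n' tP] by (simp add: e_def)
  have "?m (\<tau>' (n ?t)) = n (\<tau>' ?t)"
    using m_eq[of "\<tau>' (n ?t)"] n' \<tau>' tP by (simp add: P.inv_auto_left)
  then have "\<tau>' (n ?t) = n (\<tau>' ?t)"
    using \<open>?m = \<one>\<^bsub>AutoGroup P\<^esub>\<close> n' \<tau>' tP by (simp add: P.AutoGroup_one)
  moreover have "\<tau>' (n ?t) = a \<otimes>\<^bsub>P\<^esub> n ?t"
  proof -
    have "f (n ?t) = a" using nt e tP f_one[OF _ proj_w[OF e]] f(2) a by simp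
    then show ?thesis using n' tP by (simp add: \<tau>'_def)
  qed
  moreover have "n (\<tau>' ?t) = n a \<otimes>\<^bsub>P\<^esub> n ?t"
    using a tP f(2) by (simp add: \<tau>'_def)
  ultimately show "n a = a" using a tP n' P.right_cancel[of "n ?t" "n a" a] by simp
qed

section \<open>Construction of finite normal subgroups\<close>

text \<open>
  Dividing twice by the component in P_U inverts the vertex groups of the vertices in U and fixes
  the other vertex groups. For U contained in the set of cone vertices this component is central.
\<close>

definition flip where
  "flip U = (\<lambda>x\<in>carrier P. inv\<^bsub>P\<^esub> (proj U x \<otimes>\<^bsub>P\<^esub> proj U x) \<otimes>\<^bsub>P\<^esub> x)"

lemma flip_auto:
  assumes U: "U \<subseteq> cone"
  shows "flip U \<in> auto P" and "\<And>x. x \<in> carrier P \<Longrightarrow> flip U (flip U x) = x"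
proof -
  let ?f = "\<lambda>x. inv\<^bsub>P\<^esub> (proj U x \<otimes>\<^bsub>P\<^esub> proj U x)"
  interpret Z: subgroup P.centre P by (rule P.subgroup_centre)
  have c: "proj U x \<in> P.centre" if "x \<in> carrier P" for x
    by (rule proj_cone_centre[OF U that])
  have "(\<lambda>x. proj U x \<otimes>\<^bsub>P\<^esub> proj U x) \<in> hom P P"
    by (rule P.hom_mult_centre[OF proj_hom proj_hom c])
  then have f: "?f \<in> hom P P"
    by (rule P.hom_inv_centre) (simp add: c)
  have hom: "(\<lambda>x. ?f x \<otimes>\<^bsub>P\<^esub> x) \<in> hom P P"
    using P.hom_mult_centre[OF f, of "\<lambda>x. x"] c by (simp add: hom_def)
  have invol: "?f (?f x \<otimes>\<^bsub>P\<^esub> x) \<otimes>\<^bsub>P\<^esub> (?f x \<otimes>\<^bsub>P\<^esub> x) = x" if x: "x \<in> carrier P" for x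
  proof -
    let ?e = "proj U x"
    have e: "?e \<in> carrier P" using x by simp
    have "proj U (?f x \<otimes>\<^bsub>P\<^esub> x) = inv\<^bsub>P\<^esub> (?e \<otimes>\<^bsub>P\<^esub> ?e) \<otimes>\<^bsub>P\<^esub> ?e"
      using x by (simp add: proj_proj)
    also have "\<dots> = inv\<^bsub>P\<^esub> ?e"
      using e by (simp add: P.inv_mult_group P.m_assoc)
    finally have "?f (?f x \<otimes>\<^bsub>P\<^esub> x) = ?e \<otimes>\<^bsub>P\<^esub> ?e"
      using e by (simp only: P.inv_mult_group P.inv_closed P.inv_inv)
    moreover have "?e \<otimes>\<^bsub>P\<^esub> ?e \<otimes>\<^bsub>P\<^esub> (?f x \<otimes>\<^bsub>P\<^esub> x) = x"
      using e x P.m_assoc[of "?e \<otimes>\<^bsub>P\<^esub> ?e" "?f x" x] P.r_inv[of "?e \<otimes>\<^bsub>P\<^esub> ?e"] by simp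
    ultimately show ?thesis by (simp only:)
  qed
  show "flip U \<in> auto P"
    unfolding flip_def by (rule P.autoI[OF hom _ invol invol]) simp
  show "flip U (flip U x) = x" if "x \<in> carrier P" for x
    using invol[OF that] that by (simp add: flip_def)
qed

text \<open>
  The map inverts the centre, and it fixes every x whose retraction to the centre is trivial. This
  includes all torsion elements, because the centre is torsion-free. Any automorphism preserves
  the centre and the torsion elements, and P is generated by these two kinds of elements. So the
  flip commutes with all automorphisms.
\<close>

lemma flip_normal:
  assumes "cone \<noteq> {}" and inf: "\<And>v. v \<in> cone \<Longrightarrow> infinite (carrier (G v))"
    and fin: "\<And>w. w \<in> V - cone \<Longrightarrow> finite (carrier (G w))"
  shows "{\<one>\<^bsub>AutoGroup P\<^esub>, flip cone} \<lhd> AutoGroup P" "flip cone \<noteq> \<one>\<^bsub>AutoGroup P\<^esub>"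
proof -
  interpret A: group "AutoGroup P" by (rule P.AutoGroup)
  let ?\<sigma> = "flip cone"
  have \<sigma>: "?\<sigma> \<in> auto P" by (rule flip_auto) simp
  interpret \<sigma>: group_hom P P ?\<sigma> by (rule P.auto_group_hom[OF \<sigma>])
  have \<sigma>\<sigma>: "?\<sigma> \<otimes>\<^bsub>AutoGroup P\<^esub> ?\<sigma> = \<one>\<^bsub>AutoGroup P\<^esub>"
    using \<sigma> flip_auto(2)[OF subset_refl] by (intro P.auto_eq_one) (simp_all add: P.AutoGroup_mult)
  have \<sigma>_centre: "?\<sigma> z = inv\<^bsub>P\<^esub> z" if z: "z \<in> P.centre" for z
    using z proj_centre[OF z] by (simp add: flip_def P.inv_mult_group P.m_assoc)
  have \<sigma>_fixed: "?\<sigma> x = x" if x: "x \<in> carrier P" and "proj cone x = \<one>\<^bsub>P\<^esub>" for x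
    using that by (simp add: flip_def)
  have comm: "\<alpha> (?\<sigma> x) = ?\<sigma> (\<alpha> x)" if \<alpha>: "\<alpha> \<in> auto P" and "x \<in> carrier P" for \<alpha> x
  proof -
    interpret \<alpha>: group_hom P P \<alpha> by (rule P.auto_group_hom[OF \<alpha>])
    have "(\<alpha> \<circ> ?\<sigma>) x = (?\<sigma> \<circ> \<alpha>) x"
    proof (rule hom_eqI[OF P.is_group hom_compose[OF P.auto_hom[OF \<sigma>] P.auto_hom[OF \<alpha>]]
          hom_compose[OF P.auto_hom[OF \<alpha>] P.auto_hom[OF \<sigma>]] _ that(2)])
      fix u g assume u: "u \<in> V" and g: "g \<in> carrier (G u)"
      show "(\<alpha> \<circ> ?\<sigma>) (incl u g) = (?\<sigma> \<circ> \<alpha>) (incl u g)"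
      proof (cases "u \<in> cone")
        case True
        have c: "incl u g \<in> P.centre" by (rule incl_cone_centre[OF True g])
        show ?thesis
          using \<sigma>_centre[OF c] \<sigma>_centre[OF P.auto_centre[OF \<alpha> c]] c by simp
      next
        case False
        interpret Gu: group "G u" by (rule groups[OF u])
        interpret i: group_hom "G u" P "incl u" using incl_hom[OF u] by unfold_locales
        let ?k = "order (G u)" and ?x = "incl u g"
        have xP: "?x \<in> carrier P" using u g by simp
        have "g [^]\<^bsub>G u\<^esub> ?k = \<one>\<^bsub>G u\<^esub>" by (rule Gu.pow_order_eq_1[OF g])
        then have "?x [^]\<^bsub>P\<^esub> ?k = \<one>\<^bsub>P\<^esub>" using i.hom_nat_pow[OF g, of ?k] u by simp
        then have "\<alpha> ?x [^]\<^bsub>P\<^esub> ?k = \<one>\<^bsub>P\<^esub>"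
          using \<alpha>.hom_nat_pow[OF xP, of ?k] \<alpha>.hom_one by argo
        then have pow: "proj cone (\<alpha> ?x) [^]\<^bsub>P\<^esub> ?k = \<one>\<^bsub>P\<^esub>"
          using proj.hom_nat_pow[of "\<alpha> ?x" cone ?k] proj.hom_one[of cone] \<alpha>.hom_closed[OF xP] by argo
        have k: "?k > 0" using fin[of u] u False by (simp add: Gu.order_gt_0_iff_finite)
        have "proj cone (\<alpha> ?x) = \<one>\<^bsub>P\<^esub>"
          by (rule centre_torsion_free[OF inf proj_cone_centre[OF subset_refl \<alpha>.hom_closed[OF xP]] pow k])
        then show ?thesis using \<sigma>_fixed[of ?x] \<sigma>_fixed[of "\<alpha> ?x"] xP \<alpha> u g False by simp
      qed
    qed
    then show ?thesis by simp
  qed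
  show "{\<one>\<^bsub>AutoGroup P\<^esub>, ?\<sigma>} \<lhd> AutoGroup P"
  proof (rule A.normal_invI)
    show "subgroup {\<one>\<^bsub>AutoGroup P\<^esub>, ?\<sigma>} (AutoGroup P)"
      using \<sigma> \<sigma>\<sigma> A.inv_equality[of ?\<sigma> ?\<sigma>] by (intro A.subgroupI) auto
    show "\<alpha> \<otimes>\<^bsub>AutoGroup P\<^esub> h \<otimes>\<^bsub>AutoGroup P\<^esub> inv\<^bsub>AutoGroup P\<^esub> \<alpha> \<in> {\<one>\<^bsub>AutoGroup P\<^esub>, ?\<sigma>}"
      if "\<alpha> \<in> carrier (AutoGroup P)" "h \<in> {\<one>\<^bsub>AutoGroup P\<^esub>, ?\<sigma>}" for \<alpha> h
    proof -
      have \<alpha>: "\<alpha> \<in> auto P" using that(1) by simp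
      have "\<alpha> \<otimes>\<^bsub>AutoGroup P\<^esub> ?\<sigma> \<otimes>\<^bsub>AutoGroup P\<^esub> inv\<^bsub>AutoGroup P\<^esub> \<alpha> = ?\<sigma>"
        by (rule P.auto_eqI) (use \<alpha> \<sigma> in \<open>simp_all add: P.AutoGroup_mult comm[OF \<alpha>] P.inv_auto_right\<close>)
      then show ?thesis using that by auto
    qed
  qed
  obtain v where v: "v \<in> cone" using assms(1) by blast
  have vV: "v \<in> V" using v by (rule cone_V)
  interpret Gv: group "G v" by (rule groups[OF vV])
  obtain p where p: "p \<in> carrier (G v)" "p \<noteq> \<one>\<^bsub>G v\<^esub>"
    using nontrivial_carrier[OF vV] Gv.one_closed by blast
  let ?x = "incl v p"
  have c: "?x \<in> P.centre" by (rule incl_cone_centre[OF v p(1)])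
  show "?\<sigma> \<noteq> \<one>\<^bsub>AutoGroup P\<^esub>"
  proof
    assume "?\<sigma> = \<one>\<^bsub>AutoGroup P\<^esub>"
    then have "inv\<^bsub>P\<^esub> ?x = ?x" using \<sigma>_centre[OF c] c by (simp add: P.AutoGroup_one)
    then have "?x [^]\<^bsub>P\<^esub> (2::nat) = \<one>\<^bsub>P\<^esub>"
      using P.r_inv[of ?x] c by (simp add: numeral_2_eq_2)
    then have "?x = \<one>\<^bsub>P\<^esub>" using centre_torsion_free[OF inf c, of 2] by simp
    then show False using incl_eq_iff[OF vV p(1) Gv.one_closed] vV p(2) by simp
  qed
qed

text \<open>
  The coordinates embed the centre in a finite product of cyclic groups, and every cyclic group
  has only finitely many elements of finite order.
\<close>

lemma finite_torsion_centre: "finite P.torsion_centre"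
proof (rule finite_imageD)
  let ?T = "\<lambda>v. {p \<in> carrier (G v). \<exists>j>0::nat. p [^]\<^bsub>G v\<^esub> j = \<one>\<^bsub>G v\<^esub>}"
  let ?c = "\<lambda>z. \<lambda>v\<in>cone. coord v z"
  have fin: "finite (?T v)" if v: "v \<in> cone" for v
  proof (cases "finite (carrier (G v))")
    case False
    interpret Gv: group "G v" by (rule groups[OF cone_V[OF v]])
    have "?T v \<subseteq> {\<one>\<^bsub>G v\<^esub>}"
      using Gv.infinite_cyclic_torsion_free[OF cyclic[OF cone_V[OF v]] False] by blast
    then show ?thesis by (rule finite_subset) simp
  qed simp
  have "?c ` P.torsion_centre \<subseteq> Pi\<^sub>E cone ?T"
  proof (intro image_subsetI restrict_PiE_iff[THEN iffD2] ballI CollectI conjI)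
    fix z v assume z: "z \<in> P.torsion_centre" and v: "v \<in> cone"
    interpret c: group_hom P "G v" "coord v"
      using cone_V[OF v] coord_hom groups P.is_group by (simp add: group_hom_def group_hom_axioms_def)
    obtain j :: nat where j: "j > 0" "z [^]\<^bsub>P\<^esub> j = \<one>\<^bsub>P\<^esub>" and zP: "z \<in> carrier P"
      using z by (auto simp: P.torsion_centre_def)
    show "coord v z \<in> carrier (G v)" using zP by simp
    have "coord v z [^]\<^bsub>G v\<^esub> j = \<one>\<^bsub>G v\<^esub>"
      using c.hom_nat_pow[OF zP, of j] c.hom_one j(2) by argo
    then show "\<exists>j>0::nat. coord v z [^]\<^bsub>G v\<^esub> j = \<one>\<^bsub>G v\<^esub>" using j(1) by blast
  qed
  then show "finite (?c ` P.torsion_centre)"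
    by (rule finite_subset) (intro finite_PiE finite_subset[OF cone_subset finite_V] fin)
  show "inj_on ?c P.torsion_centre"
  proof (rule inj_onI)
    fix y z assume "y \<in> P.torsion_centre" "z \<in> P.torsion_centre" and eq: "?c y = ?c z"
    then have "y \<in> P.centre" "z \<in> P.centre" by (simp_all add: P.torsion_centre_def)
    moreover have "coord v y = coord v z" if "v \<in> cone" for v
      using fun_cong[OF eq, of v] that by simp
    ultimately show "y = z" by (rule centre_inj_coord)
  qed
qed

text \<open>
  An automorphism is determined by its displacements of the finitely many generators of the vertex
  groups. For automorphisms that are trivial modulo the torsion of the centre, each displacement
  lies in a finite set.
\<close>

lemma finite_torsion_autos: "finite P.torsion_autos"
proof -
  define t where "t u = (SOME t. t \<in> carrier (G u) \<and> carrier (G u) = range (\<lambda>n::int. t [^]\<^bsub>G u\<^esub> n))" for u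
  have t: "t u \<in> carrier (G u) \<and> carrier (G u) = range (\<lambda>n::int. t u [^]\<^bsub>G u\<^esub> n)" if u: "u \<in> V" for u
    unfolding t_def by (rule someI_ex) (rule group.cyclic_generator[OF groups[OF u] cyclic[OF u]], blast)
  let ?d = "\<lambda>\<alpha>. \<lambda>u\<in>V. \<alpha> (incl u (t u)) \<otimes>\<^bsub>P\<^esub> inv\<^bsub>P\<^esub> incl u (t u)"
  show ?thesis
  proof (rule finite_imageD)
    have "?d ` P.torsion_autos \<subseteq> Pi\<^sub>E V (\<lambda>_. P.torsion_centre)"
    proof (intro image_subsetI restrict_PiE_iff[THEN iffD2] ballI)
      fix \<alpha> u assume "\<alpha> \<in> P.torsion_autos" and u: "u \<in> V"
      then show "\<alpha> (incl u (t u)) \<otimes>\<^bsub>P\<^esub> inv\<^bsub>P\<^esub> incl u (t u) \<in> P.torsion_centre"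
        using incl_closed[OF u, of "t u"] t[OF u] unfolding P.torsion_autos_def by blast
    qed
    then show "finite (?d ` P.torsion_autos)"
      by (rule finite_subset) (intro finite_PiE finite_V finite_torsion_centre)
    show "inj_on ?d P.torsion_autos"
    proof (rule inj_onI)
      fix \<alpha> \<beta> assume "\<alpha> \<in> P.torsion_autos" "\<beta> \<in> P.torsion_autos" and eq: "?d \<alpha> = ?d \<beta>"
      then have ab: "\<alpha> \<in> auto P" "\<beta> \<in> auto P" by (simp_all add: P.torsion_autos_def)
      interpret \<alpha>: group_hom P P \<alpha> by (rule P.auto_group_hom[OF ab(1)])
      interpret \<beta>: group_hom P P \<beta> by (rule P.auto_group_hom[OF ab(2)])
      have "\<alpha> (incl u g) = \<beta> (incl u g)" if u: "u \<in> V" and g: "g \<in> carrier (G u)" for u g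
      proof -
        interpret i: group_hom "G u" P "incl u"
          using incl_hom[OF u] groups[OF u] P.is_group by (simp add: group_hom_def group_hom_axioms_def)
        have tu: "t u \<in> carrier (G u)" and tP: "incl u (t u) \<in> carrier P" using t[OF u] u by auto
        obtain i :: int where i: "g = t u [^]\<^bsub>G u\<^esub> i" using t[OF u] g by blast
        have "\<alpha> (incl u (t u)) \<otimes>\<^bsub>P\<^esub> inv\<^bsub>P\<^esub> incl u (t u) = \<beta> (incl u (t u)) \<otimes>\<^bsub>P\<^esub> inv\<^bsub>P\<^esub> incl u (t u)"
          using fun_cong[OF eq, of u] u by simp
        then have "\<alpha> (incl u (t u)) = \<beta> (incl u (t u))" using tP ab by simp
        then show ?thesis
          using tP \<alpha>.hom_int_pow[OF tP, of i] \<beta>.hom_int_pow[OF tP, of i] i.hom_int_pow[OF tu, of i]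
          by (simp add: i)
      qed
      then show "\<alpha> = \<beta>"
        using hom_eqI[OF P.is_group P.auto_hom[OF ab(1)] P.auto_hom[OF ab(2)]] by (intro P.auto_eqI ab) blast
    qed
  qed
qed

text \<open>
  The flip of G_v is trivial modulo the torsion of the centre. It can only be the identity if G_v
  has exponent 2, and the only nontrivial cyclic group with this property has order 2.
\<close>

lemma torsion_autos_trivial_imp_order_two:
  assumes trivial: "P.torsion_autos = {\<one>\<^bsub>AutoGroup P\<^esub>}" and v: "v \<in> cone" and fin: "finite (carrier (G v))"
  shows "card (carrier (G v)) = 2"
proof -
  have vV: "v \<in> V" using v by (rule cone_V)
  interpret Gv: group "G v" by (rule groups[OF vV])
  interpret i: group_hom "G v" P "incl v" using incl_hom[OF vV] by unfold_locales
  interpret T: subgroup P.torsion_centre P by (rule P.subgroup_torsion_centre)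
  have torsion: "incl v p \<in> P.torsion_centre" if p: "p \<in> carrier (G v)" for p
  proof -
    have "incl v p [^]\<^bsub>P\<^esub> order (G v) = \<one>\<^bsub>P\<^esub>"
      using i.hom_nat_pow[OF p, of "order (G v)"] Gv.pow_order_eq_1[OF p] i.hom_one by argo
    moreover have "order (G v) > 0" using fin by (simp add: Gv.order_gt_0_iff_finite)
    ultimately show ?thesis using incl_cone_centre[OF v p] by (auto simp: P.torsion_centre_def)
  qed
  have flip: "flip {v} \<in> auto P" using v by (intro flip_auto) simp
  have "flip {v} x \<otimes>\<^bsub>P\<^esub> inv\<^bsub>P\<^esub> x \<in> P.torsion_centre" if x: "x \<in> carrier P" for x
  proof -
    have "flip {v} x \<otimes>\<^bsub>P\<^esub> inv\<^bsub>P\<^esub> x = inv\<^bsub>P\<^esub> (proj {v} x \<otimes>\<^bsub>P\<^esub> proj {v} x)"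
      using x by (simp add: flip_def P.m_assoc)
    moreover have "proj {v} x \<in> P.torsion_centre"
      using torsion[of "coord v x"] hom_in_carrier[OF coord_hom[OF vV] x] incl_coord[OF vV x] by simp
    ultimately show ?thesis by simp
  qed
  then have "flip {v} \<in> P.torsion_autos" using flip by (simp add: P.torsion_autos_def)
  then have flip_one: "flip {v} = \<one>\<^bsub>AutoGroup P\<^esub>" using trivial by simp
  obtain t where t: "t \<in> carrier (G v)" "carrier (G v) = range (\<lambda>n::int. t [^]\<^bsub>G v\<^esub> n)"
    by (rule Gv.cyclic_generator[OF cyclic[OF vV]])
  have tP: "incl v t \<in> carrier P" using vV t by simp
  have "flip {v} (incl v t) = incl v t" using flip_one tP by (simp add: P.AutoGroup_one)
  then have "inv\<^bsub>P\<^esub> (incl v t \<otimes>\<^bsub>P\<^esub> incl v t) = \<one>\<^bsub>P\<^esub>"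
    using vV t tP by (simp add: flip_def P.r_cancel_one)
  then have "incl v (t \<otimes>\<^bsub>G v\<^esub> t) = incl v \<one>\<^bsub>G v\<^esub>"
    using vV t(1) tP by (simp add: incl_mult P.inv_eq_1_iff)
  then have "t \<otimes>\<^bsub>G v\<^esub> t = \<one>\<^bsub>G v\<^esub>" using incl_eq_iff[OF vV, of "t \<otimes>\<^bsub>G v\<^esub> t" "\<one>\<^bsub>G v\<^esub>"] t(1) by simp
  then have "t [^]\<^bsub>G v\<^esub> (2::nat) = \<one>\<^bsub>G v\<^esub>" using t(1) by (simp add: numeral_2_eq_2)
  then have "Gv.ord t dvd 2" using Gv.pow_eq_id[OF t(1)] by blast
  then have "Gv.ord t = 1 \<or> Gv.ord t = 2" by (metis two_is_prime_nat prime_nat_iff)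
  moreover have "Gv.ord t \<noteq> 1"
  proof
    assume "Gv.ord t = 1"
    then have "t = \<one>\<^bsub>G v\<^esub>" using Gv.ord_eq_1[OF t(1)] by simp
    then have "carrier (G v) = {\<one>\<^bsub>G v\<^esub>}" using t(2) by simp
    then show False using nontrivial_carrier[OF vV] by simp
  qed
  ultimately show ?thesis using Gv.cyclic_generator_ord(2)[OF t] by (simp add: order_def)
qed

text \<open>
  If the generator t of G_u has even or infinite order, then t |-> s defines a homomorphism to G_v
  = {1, s}, and the transvection along it is a nontrivial element of the group that is assumed to
  be trivial. Infinite order means ord t = 0, so both possibilities are covered by the parity of
  ord t.
\<close>

lemma torsion_autos_trivial_imp_odd:
  assumes trivial: "P.torsion_autos = {\<one>\<^bsub>AutoGroup P\<^esub>}" and v: "v \<in> cone" and card: "card (carrier (G v)) = 2"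
    and u: "u \<in> V" "u \<noteq> v"
  shows "finite (carrier (G u)) \<and> odd (order (G u))"
proof -
  have vV: "v \<in> V" using v by (rule cone_V)
  interpret Gv: group "G v" by (rule groups[OF vV])
  interpret Gu: group "G u" by (rule groups[OF u(1)])
  obtain s where s: "carrier (G v) = {\<one>\<^bsub>G v\<^esub>, s}" "s \<noteq> \<one>\<^bsub>G v\<^esub>" by (rule Gv.order_two_carrier[OF card])
  have sG: "s \<in> carrier (G v)" using s(1) by simp
  have ss: "s \<otimes>\<^bsub>G v\<^esub> s = \<one>\<^bsub>G v\<^esub>"
    using s Gv.m_closed[of s s] Gv.l_cancel_one[of s s] by auto
  let ?a = "incl v s"
  have a: "?a \<in> P.centre" by (rule incl_cone_centre[OF v sG])
  have aP: "?a \<in> carrier P" using a by simp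
  have "?a \<otimes>\<^bsub>P\<^esub> ?a = \<one>\<^bsub>P\<^esub>"
    using incl_mult[OF vV sG sG, symmetric] ss vV by simp
  then have a2: "?a [^]\<^bsub>P\<^esub> (2::nat) = \<one>\<^bsub>P\<^esub>" using aP by (simp add: numeral_2_eq_2)
  then have aT: "?a \<in> P.torsion_centre"
    using a by (auto simp: P.torsion_centre_def intro!: exI[of _ 2])
  obtain t where t: "t \<in> carrier (G u)" "carrier (G u) = range (\<lambda>n::int. t [^]\<^bsub>G u\<^esub> n)"
    by (rule Gu.cyclic_generator[OF cyclic[OF u(1)]])
  have "odd (Gu.ord t)"
  proof
    assume even: "even (Gu.ord t)"
    have rel: "?a [^]\<^bsub>P\<^esub> i = \<one>\<^bsub>P\<^esub>" if "t [^]\<^bsub>G u\<^esub> i = \<one>\<^bsub>G u\<^esub>" for i :: int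
    proof -
      have "int (P.ord ?a) dvd 2" using a2 P.pow_eq_id[OF aP, of 2] by (metis int_dvd_int_iff of_nat_numeral)
      moreover have "2 dvd i"
        using that Gu.int_pow_eq_id[OF t(1), of i] even by (metis dvd_trans int_dvd_int_iff of_nat_numeral)
      ultimately show ?thesis using P.int_pow_eq_id[OF aP, of i] dvd_trans by blast
    qed
    have a_u: "proj {u} ?a = \<one>\<^bsub>P\<^esub>" using vV sG u by simp
    obtain f where f: "f \<in> hom P P" "f (incl u t) = ?a" and \<tau>: "(\<lambda>x\<in>carrier P. f x \<otimes>\<^bsub>P\<^esub> x) \<in> auto P"
      and f_in: "\<And>M x. subgroup M P \<Longrightarrow> ?a \<in> M \<Longrightarrow> x \<in> carrier P \<Longrightarrow> f x \<in> M"
      by (rule obtain_central_transvection[OF u(1) t a a_u rel], assumption) (rule that)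
    have fT: "f x \<in> P.torsion_centre" if "x \<in> carrier P" for x
      by (rule f_in[OF P.subgroup_torsion_centre aT that])
    then have fP: "f x \<in> carrier P" if "x \<in> carrier P" for x
      using that by (auto simp: P.torsion_centre_def)
    have "(\<lambda>x\<in>carrier P. f x \<otimes>\<^bsub>P\<^esub> x) \<in> P.torsion_autos"
      using \<tau> fT fP by (simp add: P.torsion_autos_def P.m_assoc)
    then have \<tau>_one: "(\<lambda>x\<in>carrier P. f x \<otimes>\<^bsub>P\<^esub> x) = \<one>\<^bsub>AutoGroup P\<^esub>" using trivial by simp
    have tP: "incl u t \<in> carrier P" using u t by simp
    have "?a \<otimes>\<^bsub>P\<^esub> incl u t = (\<lambda>x\<in>carrier P. f x \<otimes>\<^bsub>P\<^esub> x) (incl u t)" using tP f(2) by simp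
    also have "\<dots> = incl u t" unfolding \<tau>_one by (rule P.AutoGroup_one[OF tP])
    finally have "?a \<otimes>\<^bsub>P\<^esub> incl u t = incl u t" .
    then have "incl v s = \<one>\<^bsub>P\<^esub>" using tP aP by (simp add: P.r_cancel_one)
    then show False using incl_eq_iff[OF vV sG Gv.one_closed] vV s(2) by simp
  qed
  then show ?thesis
    using Gu.cyclic_generator_ord[OF t] by (metis even_zero)
qed

lemma card_single_vertex:
  assumes "V = {v}"
  shows "card (carrier P) = card (carrier (G v))"
proof -
  have v: "v \<in> V" using assms by simp
  have "bij_betw (incl v) (carrier (G v)) (carrier P)"
  proof (rule bij_betw_byWitness[where f' = "coord v"])
    show "\<forall>g\<in>carrier (G v). coord v (incl v g) = g" using v by (simp add: coord_incl)
    show "\<forall>x\<in>carrier P. incl v (coord v x) = x"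
      using v assms by (simp add: incl_coord proj_superset)
    show "incl v ` carrier (G v) \<subseteq> carrier P" using v by auto
    show "coord v ` carrier P \<subseteq> carrier (G v)" using hom_in_carrier[OF coord_hom[OF v]] by auto
  qed
  then show ?thesis using bij_betw_same_card by metis
qed

end

section \<open>The classification\<close>

theorem theoremG:
  fixes \<Gamma> :: "'v pair_pre_digraph"
    and G :: "'v \<Rightarrow> ('a, 'b) monoid_scheme"
    and \<Delta> :: "('v, 'v \<times> 'v) pre_digraph"
  assumes "pair_graph \<Gamma>"
    and "\<And>v. v \<in> pverts \<Gamma> \<Longrightarrow> group (G v)"
    and "\<And>v. v \<in> pverts \<Gamma> \<Longrightarrow> \<not> trivial_group (G v)"
    and "\<And>v. v \<in> pverts \<Gamma> \<Longrightarrow> cyclic_group (G v)"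
    and "\<And>v. v \<in> pverts \<Gamma> \<Longrightarrow> finite (carrier (G v)) \<Longrightarrow> primepow (order (G v))"
    and "\<Delta> = with_proj \<Gamma> \<restriction> {v \<in> pverts \<Gamma>. star \<Gamma> v = pverts \<Gamma>}"
  shows "\<not> (\<exists>N. N \<lhd> AutoGroup (graph_product \<Gamma> G) \<and> finite N
              \<and> N \<noteq> {\<one>\<^bsub>AutoGroup (graph_product \<Gamma> G)\<^esub>})
    \<longleftrightarrow>
      verts \<Delta> = {}
    \<or> graph_product \<Gamma> G \<cong> integer_mod_group 2
    \<or> (\<exists>v\<^sub>1. verts \<Delta> = {v\<^sub>1} \<and> G v\<^sub>1 \<cong> integer_mod_group 2
         \<and> card (pverts \<Gamma> - verts \<Delta>) \<ge> 1
         \<and> (\<forall>w \<in> pverts \<Gamma> - verts \<Delta>. finite (carrier (G w)) \<and> \<not> 2 dvd order (G w)))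
    \<or> ((\<forall>v \<in> verts \<Delta>. G v \<cong> integer_group)
         \<and> (\<exists>w \<in> pverts \<Gamma> - verts \<Delta>. G w \<cong> integer_group))"
    (is "?L \<longleftrightarrow> ?i \<or> ?ii \<or> ?iii \<or> ?iv")
proof -
  interpret graph_of_cyclic_groups \<Gamma> G
    by (intro graph_of_cyclic_groups.intro graph_of_groups.intro graph_of_cyclic_groups_axioms.intro assms(1-4))
  have \<Delta>: "verts \<Delta> = cone" by (simp add: assms(6) cone_def)
  have card_mod2: "card (carrier (integer_mod_group 2)) = 2" by (simp add: carrier_integer_mod_group)
  have iso_infinite: "infinite (carrier (G v))" if "G v \<cong> integer_group" for v
    using iso_finite[OF that] by simp
  have all_trivial: ?L if "\<And>N n. N \<lhd> AutoGroup P \<Longrightarrow> finite N \<Longrightarrow> n \<in> N \<Longrightarrow> n = \<one>\<^bsub>AutoGroup P\<^esub>"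
  proof (intro notI, elim exE conjE)
    fix N assume N: "N \<lhd> AutoGroup P" "finite N" and "N \<noteq> {\<one>\<^bsub>AutoGroup P\<^esub>}"
    moreover have "\<one>\<^bsub>AutoGroup P\<^esub> \<in> N"
      using normal_imp_subgroup[OF N(1)] by (rule subgroup.one_closed)
    ultimately show False using that[OF N] by blast
  qed
  show ?thesis
  proof
    assume "?i \<or> ?ii \<or> ?iii \<or> ?iv"
    then show ?L
    proof (elim disjE)
      assume ?i
      then show ?L using finite_normal_trivial_no_cone by (intro all_trivial) (auto simp: \<Delta>)
    next
      assume ?ii
      then have "card (carrier P) = 2" using iso_same_card card_mod2 by metis
      then show ?L
        using P.auto_of_order_two_trivial normal_autos_auto by (intro all_trivial) blast
    next
      assume ?iii
      then obtain a where a: "cone = {a}" "G a \<cong> integer_mod_group 2"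
        and odd: "\<And>w. w \<in> V - {a} \<Longrightarrow> finite (carrier (G w)) \<and> odd (order (G w))"
        unfolding \<Delta> by blast
      have "card (carrier (G a)) = 2" using iso_same_card[OF a(2)] card_mod2 by simp
      then show ?L using finite_normal_trivial_involution_cone[OF _ _ a(1) _ odd] by (intro all_trivial) blast
    next
      assume ?iv
      then obtain w where "w \<in> V - cone" "G w \<cong> integer_group" and "\<And>v. v \<in> cone \<Longrightarrow> G v \<cong> integer_group"
        unfolding \<Delta> by blast
      then show ?L using finite_normal_trivial_infinite_vertex iso_infinite by (intro all_trivial) metis
    qed
  next
    assume L: ?L
    show "?i \<or> ?ii \<or> ?iii \<or> ?iv"
    proof (cases "\<exists>v\<in>cone. finite (carrier (G v))")
      case True
      then obtain v where v: "v \<in> cone" "finite (carrier (G v))" by blast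
      have vV: "v \<in> V" using v(1) by (rule cone_V)
      have trivial: "P.torsion_autos = {\<one>\<^bsub>AutoGroup P\<^esub>}"
        using L P.normal_torsion_autos finite_torsion_autos by blast
      have card: "card (carrier (G v)) = 2" by (rule torsion_autos_trivial_imp_order_two[OF trivial v])
      have odd: "finite (carrier (G u)) \<and> odd (order (G u))" if "u \<in> V" "u \<noteq> v" for u
        by (rule torsion_autos_trivial_imp_odd[OF trivial v(1) card that])
      have "u = v" if u: "u \<in> cone" for u
      proof (rule ccontr)
        assume "u \<noteq> v"
        then have "finite (carrier (G u)) \<and> odd (card (carrier (G u)))"
          using odd[OF cone_V[OF u]] by (simp add: order_def)
        then show False using torsion_autos_trivial_imp_order_two[OF trivial u] by simp
      qed
      then have cone: "cone = {v}" using v(1) by blast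
      show ?thesis
      proof (cases "V = {v}")
        case True
        then have ?ii using P.order_two_iso card_single_vertex[OF True] card by simp
        then show ?thesis by blast
      next
        case False
        then have "V - {v} \<noteq> {}" using vV by blast
        then have "card (V - {v}) \<ge> 1" using finite_V by (simp add: card_gt_0_iff Suc_le_eq)
        then have ?iii
          using cone odd group.order_two_iso[OF groups[OF vV] card] by (simp add: \<Delta>)
        then show ?thesis by blast
      qed
    next
      case False
      then have inf: "infinite (carrier (G v))" if "v \<in> cone" for v using that by blast
      have iso: "G v \<cong> integer_group" if "v \<in> V" "infinite (carrier (G v))" for v
        by (rule group.infinite_cyclic_iso[OF groups[OF that(1)] cyclic[OF that(1)] that(2)])
      show ?thesis
      proof (cases "cone = {} \<or> (\<exists>w\<in>V - cone. infinite (carrier (G w)))")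
        case True
        then show ?thesis using iso inf cone_V unfolding \<Delta> by blast
      next
        case False
        then have "{\<one>\<^bsub>AutoGroup P\<^esub>, flip cone} \<lhd> AutoGroup P" "flip cone \<noteq> \<one>\<^bsub>AutoGroup P\<^esub>"
          using flip_normal inf by blast+
        then show ?thesis using L by blast
      qed
    qed
  qed
qed

end
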